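(* Consider, for fixed $\nu\in\mathbb{R}$, $\nu\neq 0$, the family, with real parameters $(a,s)\in\mathbb{R}^2$, of differential equations on the torus $\mathbb{T}^2=S^1\times S^1$, $S^1=\mathbb{R}/2\pi\mathbb{Z}$, with coordinates $(x,t)$, $$\frac{dx}{dt}=\nu\sin x+a+s\sin t ,$$ and let $\rho(a,s)$ be its rotation number. For every $\nu\neq0$ and every $r\in\mathbb{Z}$ there exists $M=M(\nu,r)>0$ such that every adjacency $(a,s)$ of the $r$-th Arnold tongue $\{\rho(a,s)=r\}$ with $|s|>M$ lies on the line $a=r$.
   Context: The period $2\pi$ flow map of the equation (from $t=0$ to $t=2\pi$) is a circle diffeomorphism $h_{a,s}:S^1\to S^1$. The rotation number $\rho(a,s)\in\mathbb{R}$ is normalized as rotation angle divided by $2\pi$: if $x(t)\in\mathbb{R}$ is any solution of the equation lifted to the real line, then $\rho(a,s)=\lim_{n\to\infty}\frac{x(2\pi n)-x(0)}{2\pi n}$. For $\nu\ne0$ fixed, the $r$-th Arnold tongue is the level set $\{(a,s)\in\mathbb{R}^2:\rho(a,s)=r\}$, provided it has non-empty interior. It is known that Arnold tongues exist only for integer $r$, and that the boundary of the $r$-th tongue consists of two analytic curves which are graphs $a=g_r^-(s)$ and $a=g_r^+(s)$. For each $s$, the horizontal slice of the tongue is the segment with endpoints $g_r^-(s)$ and $g_r^+(s)$. An adjacency of the $r$-th Arnold tongue is a point $(a,s)$ with $s\neq 0$ at which the two boundary curves meet, i.e. $a=g_r^-(s)=g_r^+(s)$. Equivalently, $s\ne0$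 and $a$ is the only real number $a'$ with $\rho(a',s)=r$. (Points with $s=0$ are not counted as adjacencies.) *)

theory Defs
  imports "HOL-Analysis.Analysis"
begin

text \<open>
  The equation on the torus is handled through its lift to the real line: the right-hand side is
  \<open>2\<pi>\<close>-periodic in \<open>x\<close> and in \<open>t\<close>, and is bounded, so all solutions are defined for all times.
\<close>

definition solves_lift :: "real \<Rightarrow> real \<Rightarrow> real \<Rightarrow> (real \<Rightarrow> real) \<Rightarrow> bool" where
  "solves_lift \<nu> a s x \<longleftrightarrow>
     (\<forall>t. (x has_real_derivative (\<nu> * sin (x t) + a + s * sin t)) (at t))"

text \<open>
  The limit exists and is independent of the solution; hence the definite description.
\<close>

definition rotation_number :: "real \<Rightarrow> real \<Rightarrow> real \<Rightarrow> real" where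
  "rotation_number \<nu> a s =
     (THE \<rho>. \<forall>x. solves_lift \<nu> a s x \<longrightarrow>
        (\<lambda>n. (x (2 * pi * real n) - x 0) / (2 * pi * real n)) \<longlonglongrightarrow> \<rho>)"

text \<open>
  For \<open>\<nu> \<noteq> 0\<close> this level set has non-empty interior exactly when \<open>r\<close> is an integer, so for
  integer \<open>r\<close> the usual proviso in the definition of a tongue is automatic.
\<close>

definition arnold_tongue :: "real \<Rightarrow> real \<Rightarrow> (real \<times> real) set" where
  "arnold_tongue \<nu> r = {(a, s). rotation_number \<nu> a s = r}"

text \<open>
  The boundary curves \<open>a = g\<^sub>r\<^sup>-(s)\<close> and \<open>a = g\<^sub>r\<^sup>+(s)\<close>: the endpoints of the horizontal slice at
  height \<open>s\<close>, which for integer \<open>r\<close> is a non-empty compact segment (possibly a single point).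
\<close>

definition tongue_slice :: "real \<Rightarrow> real \<Rightarrow> real \<Rightarrow> real set" where
  "tongue_slice \<nu> r s = {a. (a, s) \<in> arnold_tongue \<nu> r}"

definition left_boundary :: "real \<Rightarrow> real \<Rightarrow> real \<Rightarrow> real" where
  "left_boundary \<nu> r s = Inf (tongue_slice \<nu> r s)"

definition right_boundary :: "real \<Rightarrow> real \<Rightarrow> real \<Rightarrow> real" where
  "right_boundary \<nu> r s = Sup (tongue_slice \<nu> r s)"

definition is_adjacency :: "real \<Rightarrow> real \<Rightarrow> real \<times> real \<Rightarrow> bool" where
  "is_adjacency \<nu> r = (\<lambda>(a, s).
     s \<noteq> 0 \<and> a = left_boundary \<nu> r s \<and> a = right_boundary \<nu> r s)"

lemma boundary_of_segment:
  assumes "tongue_slice \<nu> r s = {l..u}" and "l \<le> u"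
  shows "left_boundary \<nu> r s = l" and "right_boundary \<nu> r s = u"
  using assms by (simp_all add: left_boundary_def right_boundary_def)

lemma is_adjacency_iff_unique:
  assumes "tongue_slice \<nu> r s = {l..u}" and "l \<le> u"
  shows "is_adjacency \<nu> r (a, s) \<longleftrightarrow>
    s \<noteq> 0 \<and> (\<forall>a'. rotation_number \<nu> a' s = r \<longleftrightarrow> a' = a)"
proof -
  have "rotation_number \<nu> a' s = r \<longleftrightarrow> a' \<in> {l..u}" for a'
    unfolding assms(1)[symmetric] by (simp add: tongue_slice_def arnold_tongue_def)
  moreover have "(\<forall>a'. a' \<in> {l..u} \<longleftrightarrow> a' = a) \<longleftrightarrow> a = l \<and> a = u"
    using assms(2) by (metis atLeastAtMost_iff order_antisym order_refl)
  ultimately show ?thesis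
    by (simp add: is_adjacency_def boundary_of_segment[OF assms])
qed

end

theory Submission
  imports Defs
begin

text \<open>
  If the period map moved some point by more or less than \<open>2\<pi>r\<close>, then by continuity and monotonicity
  in \<open>a\<close> the rotation number would still be \<open>r\<close> for some \<open>a' \<noteq> a\<close>. So at an adjacency the period map
  is the translation by \<open>2\<pi>r\<close>. Writing \<open>e\<^sup>i\<^sup>x = u / v\<close> turns the equation
  into a linear system; its monodromy is then a scalar \<open>\<lambda>\<close>, and Liouville's formula gives
  \<open>\<lambda>\<^sup>2 = e\<^sup>2\<^sup>\<pi>\<^sup>i\<^sup>a\<close>. If \<open>a\<close> were not an integer, then \<open>\<lambda> = e\<^sup>2\<^sup>\<pi>\<^sup>i\<^sup>\<mu>\<close> with \<open>\<mu>\<close> not an integer, and the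
  Fourier coefficients of \<open>e\<^sup>-\<^sup>i\<^sup>\<mu>\<^sup>t u\<close> satisfy a three-term recurrence whose Casoratian has constant
  modulus. The coefficients decay, so the Casoratian vanishes and any two solutions of the system are
  proportional, which is absurd. Hence \<open>a\<close> is an integer. Finally
  \<open>2\<pi>(r - a) = \<nu> \<integral> sin x\<close> over a period is small for large \<open>|s|\<close>, because the phase \<open>x\<close> is
  stationary only near the zeros of \<open>sin t\<close>; hence \<open>|r - a| < 1\<close>.
\<close>

subsection \<open>Solutions of the equation\<close>

lemma antiderivative_exists:
  fixes f :: "real \<Rightarrow> 'a::euclidean_space"
  assumes "continuous_on UNIV f"
  obtains G where "G 0 = 0" "\<And>t. (G has_vector_derivative f t) (at t)"
proof -
  have "\<exists>F. \<forall>x::real. - \<infinity> < ereal x \<longrightarrow> ereal x < \<infinity> \<longrightarrow> (F has_vector_derivative f x) (at x)"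
    by (rule einterval_antiderivative) (use assms in \<open>auto simp: continuous_on_eq_continuous_at\<close>)
  then obtain F where F: "\<And>x. (F has_vector_derivative f x) (at x)" by auto
  show thesis
  proof
    show "((\<lambda>t. F t - F 0) has_vector_derivative f t) (at t)" for t
      using F by (auto intro!: derivative_eq_intros)
  qed simp
qed

text \<open>Integrating the bound on \<open>h'\<close> from 0 gains the factor \<open>1 / L\<close>,
  which is what makes the Picard operator contract. Negative times follow by reflection.\<close>

lemma exp_weighted_derivative_bound:
  fixes h :: "real \<Rightarrow> 'a::real_normed_vector"
  assumes "L > 0" "K \<ge> 0" "h 0 = 0"
    and h: "\<And>t. (h has_vector_derivative h' t) (at t)"
    and bd: "\<And>t. norm (h' t) \<le> K * exp (L * \<bar>t\<bar>)"
  shows "norm (h t) \<le> K / L * exp (L * \<bar>t\<bar>)"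
proof -
  have key: "norm (g t) \<le> K / L * exp (L * t)"
    if "t > 0" "g 0 = 0" and g: "\<And>t. (g has_vector_derivative g' t) (at t)"
      and bd: "\<And>t. norm (g' t) \<le> K * exp (L * \<bar>t\<bar>)" for g g' :: "real \<Rightarrow> 'a" and t
  proof -
    have "norm (g t - g 0) \<le> K / L * exp (L * t) - K / L * exp (L * 0)"
    proof (rule differentiable_bound_general[where f' = g' and \<phi>' = "\<lambda>t. K * exp (L * t)"])
      show "continuous_on {0..t} g"
        using g by (meson continuous_at_imp_continuous_on has_vector_derivative_continuous)
      show "((\<lambda>t. K / L * exp (L * t)) has_vector_derivative K * exp (L * x)) (at x)" for x
        using \<open>L > 0\<close>
        by (auto intro!: derivative_eq_intros simp flip: has_real_derivative_iff_has_vector_derivative)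
      show "norm (g' x) \<le> K * exp (L * x)" if "0 < x" for x
        using bd[of x] that by simp
    qed (use that \<open>L > 0\<close> in \<open>auto intro!: continuous_intros\<close>)
    then show ?thesis
      using \<open>g 0 = 0\<close> \<open>L > 0\<close> \<open>K \<ge> 0\<close> by (simp add: field_simps)
  qed
  consider "t > 0" | "t = 0" | "t < 0" by linarith
  then show ?thesis
  proof cases
    case 1
    then show ?thesis using key[OF 1 \<open>h 0 = 0\<close> h bd] by simp
  next
    case 3
    have "((\<lambda>t. h (- t)) has_vector_derivative - h' (- t)) (at t)" for t
    proof -
      have "((h \<circ> uminus) has_vector_derivative (- 1) *\<^sub>R h' (- t)) (at t)"
        by (rule vector_diff_chain_at) (use h in \<open>auto intro!: derivative_eq_intros\<close>)
      then show ?thesis by (simp add: o_def)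
    qed
    from key[OF _ _ this, of "- t"] bd \<open>h 0 = 0\<close> 3 show ?thesis
      by (smt (verit, ccfv_SIG) abs_minus_cancel minus_minus norm_minus_cancel)
  qed (use assms in simp)
qed

text \<open>The Picard operator is a contraction for the norm weighted by \<open>exp (- 2 L \<bar>t\<bar>)\<close>, which
  yields the solution on the whole line at once.\<close>

lemma global_solution_exists:
  fixes F :: "real \<Rightarrow> real \<Rightarrow> real"
  assumes cont: "continuous_on UNIV (\<lambda>(t, x). F t x)"
    and "L > 0" and lip: "\<And>t x y. \<bar>F t x - F t y\<bar> \<le> L * \<bar>x - y\<bar>"
    and bd: "\<And>t x. \<bar>F t x\<bar> \<le> C"
  obtains x where "x 0 = x0" "\<And>t. (x has_real_derivative F t (x t)) (at t)"
proof -
  define W where "W t = exp (2 * L * \<bar>t\<bar>)" for t :: real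
  have W: "W t > 0" "W t \<ge> 1" for t using \<open>L > 0\<close> by (simp_all add: W_def)
  have contW: "continuous_on UNIV W" unfolding W_def by (intro continuous_intros)
  have "C \<ge> 0" using bd[of 0 0] by linarith
  \<comment> \<open>The unknown \<open>y\<close> is the solution divided by the weight
    \<open>W\<close>. The weighted norm thus becomes the sup norm on bounded continuous functions, a
    complete space.\<close>
  have "\<exists>G. G 0 = 0 \<and> (\<forall>t. (G has_vector_derivative F t (W t * apply_bcontfun y t)) (at t))" for y
  proof -
    have "continuous_on UNIV (\<lambda>t. F t (W t * apply_bcontfun y t))"
      by (rule continuous_on_compose2[OF cont, of UNIV "\<lambda>t. (t, W t * apply_bcontfun y t)", simplified])
         (intro continuous_intros contW continuous_on_apply_bcontfun)
    then show ?thesis by (rule antiderivative_exists) blast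
  qed
  then obtain G where G0: "G y 0 = 0"
    and G: "(G y has_vector_derivative F t (W t * apply_bcontfun y t)) (at t)" for y t by metis
  have Gcont: "continuous_on UNIV (G y)" for y
    using G by (meson continuous_at_imp_continuous_on has_vector_derivative_continuous)
  have Gbd: "\<bar>G y t\<bar> \<le> C / (2 * L) * W t" for y t
  proof -
    have "norm (G y t) \<le> C / (2 * L) * exp (2 * L * \<bar>t\<bar>)"
    proof (rule exp_weighted_derivative_bound[OF _ \<open>C \<ge> 0\<close> G0 G])
      fix t
      have "1 * C \<le> exp (2 * L * \<bar>t\<bar>) * C"
        using \<open>L > 0\<close> \<open>C \<ge> 0\<close> by (intro mult_right_mono) auto
      then show "norm (F t (W t * apply_bcontfun y t)) \<le> C * exp (2 * L * \<bar>t\<bar>)"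
        using bd[of t "W t * apply_bcontfun y t"] by (simp add: mult.commute)
    qed (use \<open>L > 0\<close> in simp)
    then show ?thesis by (simp add: W_def)
  qed
  define T where "T y = Bcontfun (\<lambda>t. (x0 + G y t) / W t)" for y
  have T: "apply_bcontfun (T y) t = (x0 + G y t) / W t" for y t
  proof -
    have "(\<lambda>t. (x0 + G y t) / W t) \<in> bcontfun"
    proof (rule bcontfun_normI)
      show "continuous_on UNIV (\<lambda>t. (x0 + G y t) / W t)"
        by (intro continuous_intros Gcont contW) (use W in \<open>simp add: less_imp_neq[symmetric]\<close>)
      fix t
      have "\<bar>x0 + G y t\<bar> \<le> \<bar>x0\<bar> * W t + C / (2 * L) * W t"
        using Gbd[of y t] W(2)[of t] mult_left_mono[OF W(2)[of t], of "\<bar>x0\<bar>"] by simp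
      then show "norm ((x0 + G y t) / W t) \<le> \<bar>x0\<bar> + C / (2 * L)"
        using W(1)[of t] by (simp add: abs_divide pos_divide_le_eq ring_distribs)
    qed
    then show ?thesis by (simp add: T_def Bcontfun_inverse)
  qed
  have "\<exists>!y. T y = y"
  proof (rule banach_fix_type[of "1/2"], simp_all, intro allI)
    fix y z
    have "dist (T y) (T z) \<le> dist y z / 2"
    proof (rule dist_bound)
      fix t
      \<comment> \<open>The weight grows at rate \<open>2 * L\<close>, twice the Lipschitz constant,
        hence the contraction factor 1/2.\<close>
      have "norm (G y t - G z t) \<le> (L * dist y z) / (2 * L) * exp (2 * L * \<bar>t\<bar>)"
      proof (rule exp_weighted_derivative_bound)
        show "((\<lambda>t. G y t - G z t) has_vector_derivative
                F t (W t * apply_bcontfun y t) - F t (W t * apply_bcontfun z t)) (at t)" for t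
          by (intro derivative_intros G)
        fix t
        have "\<bar>F t (W t * apply_bcontfun y t) - F t (W t * apply_bcontfun z t)\<bar>
            \<le> L * \<bar>W t * apply_bcontfun y t - W t * apply_bcontfun z t\<bar>" by (rule lip)
        also have "\<dots> = L * (W t * dist (apply_bcontfun y t) (apply_bcontfun z t))"
          using W(1)[of t] by (simp add: dist_real_def abs_mult flip: right_diff_distrib)
        also have "\<dots> \<le> L * (W t * dist y z)"
          using \<open>L > 0\<close> W(1)[of t] by (intro mult_left_mono dist_bounded) auto
        finally show "norm (F t (W t * apply_bcontfun y t) - F t (W t * apply_bcontfun z t))
            \<le> L * dist y z * exp (2 * L * \<bar>t\<bar>)" by (simp add: W_def mult_ac)
      qed (use \<open>L > 0\<close> G0 in auto)
      then have "\<bar>G y t - G z t\<bar> \<le> dist y z / 2 * W t" using \<open>L > 0\<close> by (simp add: W_def)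
      then show "dist (apply_bcontfun (T y) t) (apply_bcontfun (T z) t) \<le> dist y z / 2"
        using W(1)[of t]
        by (simp add: T dist_real_def abs_divide pos_divide_le_eq flip: diff_divide_distrib)
    qed
    then show "dist (T y) (T z) * 2 \<le> dist y z" by simp
  qed
  then obtain y where y: "T y = y" by blast
  have eq: "W t * apply_bcontfun y t = x0 + G y t" for t
    using T[of y t] W(1)[of t] by (simp add: y)
  show thesis
  proof
    show "W 0 * apply_bcontfun y 0 = x0" using G0 by (simp add: eq)
    have "((\<lambda>t. x0 + G y t) has_vector_derivative F t (W t * apply_bcontfun y t)) (at t)" for t
      using G[of y t] by (auto intro!: derivative_eq_intros)
    then show "((\<lambda>t. W t * apply_bcontfun y t) has_real_derivative
        F t (W t * apply_bcontfun y t)) (at t)" for t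
      by (simp add: eq has_real_derivative_iff_has_vector_derivative)
  qed
qed

lemma sin_lipschitz: "\<bar>sin x - sin y\<bar> \<le> \<bar>x - y\<bar>" for x y :: real
proof -
  have "norm (sin x - sin y) \<le> 1 * norm (x - y)"
    by (rule field_differentiable_bound[OF convex_UNIV DERIV_sin[THEN DERIV_subset]]) auto
  then show ?thesis by simp
qed

lemma solves_lift_exists: "\<exists>x. solves_lift \<nu> a s x \<and> x 0 = x0"
proof -
  obtain x where "x 0 = x0" "\<And>t. (x has_real_derivative \<nu> * sin (x t) + a + s * sin t) (at t)"
  \<comment> \<open>The Lipschitz constant must be positive and \<nu> may be zero here, hence the
    added 1.\<close>
  proof (rule global_solution_exists[of "\<lambda>t x. \<nu> * sin x + a + s * sin t" "\<bar>\<nu>\<bar> + 1" "\<bar>\<nu>\<bar> + \<bar>a\<bar> + \<bar>s\<bar>"])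
    show "continuous_on UNIV (\<lambda>(t, x). \<nu> * sin x + a + s * sin t)"
      by (auto simp: case_prod_unfold intro!: continuous_intros)
    show "\<bar>\<nu> * sin x + a + s * sin t - (\<nu> * sin y + a + s * sin t)\<bar> \<le> (\<bar>\<nu>\<bar> + 1) * \<bar>x - y\<bar>" for t x y
    proof -
      have "\<bar>\<nu> * sin x + a + s * sin t - (\<nu> * sin y + a + s * sin t)\<bar> = \<bar>\<nu>\<bar> * \<bar>sin x - sin y\<bar>"
        by (simp flip: abs_mult right_diff_distrib)
      also have "\<dots> \<le> (\<bar>\<nu>\<bar> + 1) * \<bar>x - y\<bar>" by (intro mult_mono sin_lipschitz) auto
      finally show ?thesis .
    qed
    have m: "\<bar>c * sin x\<bar> \<le> \<bar>c\<bar>" for c x :: real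
      by (simp add: abs_mult mult_left_le)
    show "\<bar>\<nu> * sin x + a + s * sin t\<bar> \<le> \<bar>\<nu>\<bar> + \<bar>a\<bar> + \<bar>s\<bar>" for t x
      using m[of \<nu> x] m[of s t] by linarith
  qed auto
  then show ?thesis unfolding solves_lift_def by blast
qed

section \<open>Symmetries, order preservation and parameter dependence of solutions\<close>

lemma solves_lift_shift:
  assumes "solves_lift \<nu> a s x"
  shows "solves_lift \<nu> a s (\<lambda>t. x (t + 2 * pi * real n) + 2 * pi * of_int k)"
  unfolding solves_lift_def
proof
  fix t
  have "(x has_real_derivative
      \<nu> * sin (x (t + 2 * pi * real n)) + a + s * sin (t + 2 * pi * real n)) (at (t + 2 * pi * real n))"
    using assms by (simp add: solves_lift_def)
  then have "((\<lambda>t. x (t + 2 * pi * real n)) has_real_derivative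
      \<nu> * sin (x (t + 2 * pi * real n)) + a + s * sin (t + 2 * pi * real n)) (at t)"
    by (simp only: DERIV_shift)
  moreover have "sin (t + 2 * pi * real n) = sin t"
    using sin.plus_of_nat[of t n] by (simp add: mult_ac)
  moreover have "sin (y + 2 * pi * of_int k) = sin y" for y
    using sin.plus_of_int[of y k] by (simp add: mult_ac)
  ultimately show "((\<lambda>t. x (t + 2 * pi * real n) + 2 * pi * of_int k) has_real_derivative
      \<nu> * sin (x (t + 2 * pi * real n) + 2 * pi * of_int k) + a + s * sin t) (at t)"
    by (auto intro!: derivative_eq_intros)
qed

lemma solves_lift_add_int:
  "solves_lift \<nu> a s x \<Longrightarrow> solves_lift \<nu> a s (\<lambda>t. x t + 2 * pi * of_int k)"
  using solves_lift_shift[of \<nu> a s x 0 k] by simp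

lemma solves_lift_shift_time:
  "solves_lift \<nu> a s x \<Longrightarrow> solves_lift \<nu> a s (\<lambda>t. x (t + 2 * pi * real n))"
  using solves_lift_shift[of \<nu> a s x n 0] by simp

lemma solves_lift_continuous: "solves_lift \<nu> a s x \<Longrightarrow> continuous_on A x"
  unfolding solves_lift_def by (meson DERIV_isCont continuous_at_imp_continuous_on)

text \<open>After the last time \<open>t0\<close> at which the difference \<open>d\<close> of the
  solutions is nonnegative, \<open>d\<close> is negative and its derivative is at least
  \<open>\<bar>\<nu>\<bar> * d\<close>. So
  \<open>exp (- \<bar>\<nu>\<bar> * \<tau>) * d \<tau>\<close> cannot decrease from a nonnegative
  value to a negative one.\<close>

lemma solves_lift_mono:
  assumes x: "solves_lift \<nu> a s x" and y: "solves_lift \<nu> b s y"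
    and "a \<le> b" "x 0 \<le> y 0" "0 \<le> t"
  shows "x t \<le> y t"
proof (rule ccontr)
  assume "\<not> x t \<le> y t"
  define d where "d \<tau> = y \<tau> - x \<tau>" for \<tau>
  have d: "(d has_real_derivative \<nu> * (sin (y \<tau>) - sin (x \<tau>)) + (b - a)) (at \<tau>)" for \<tau>
    using x y unfolding d_def solves_lift_def
    by (auto intro!: derivative_eq_intros simp: algebra_simps)
  have cd: "continuous_on A d" for A
    using d by (meson DERIV_isCont continuous_at_imp_continuous_on)
  define S where "S = {0..t} \<inter> d -` {0..}"
  have "compact S" unfolding S_def
    by (intro compact_Int_closed continuous_closed_vimage) (use DERIV_isCont[OF d] in auto)
  moreover have "0 \<in> S" using assms by (simp add: S_def d_def)
  ultimately obtain t0 where t0: "t0 \<in> S" "\<And>\<tau>. \<tau> \<in> S \<Longrightarrow> \<tau> \<le> t0"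
    using compact_attains_sup[of S] by blast
  have "t0 < t" using t0(1) \<open>\<not> x t \<le> y t\<close> by (cases "t0 = t") (auto simp: S_def d_def)
  have "exp (- \<bar>\<nu>\<bar> * t0) * d t0 \<le> exp (- \<bar>\<nu>\<bar> * t) * d t"
  proof (rule DERIV_nonneg_imp_increasing_open[where f = "\<lambda>\<tau>. exp (- \<bar>\<nu>\<bar> * \<tau>) * d \<tau>"])
    fix \<tau> assume \<tau>: "t0 < \<tau>" "\<tau> < t"
    then have "d \<tau> < 0" using t0(1) t0(2)[of \<tau>] by (fastforce simp: S_def)
    have "\<bar>\<nu> * (sin (y \<tau>) - sin (x \<tau>))\<bar> \<le> \<bar>\<nu>\<bar> * \<bar>d \<tau>\<bar>"
      unfolding abs_mult d_def by (intro mult_left_mono sin_lipschitz) auto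
    then have "\<nu> * (sin (y \<tau>) - sin (x \<tau>)) + (b - a) \<ge> \<bar>\<nu>\<bar> * d \<tau>"
      using \<open>d \<tau> < 0\<close> \<open>a \<le> b\<close> by (simp add: abs_if[of "d \<tau>"])
    then have "exp (- \<bar>\<nu>\<bar> * \<tau>) * (\<nu> * (sin (y \<tau>) - sin (x \<tau>)) + (b - a) - \<bar>\<nu>\<bar> * d \<tau>) \<ge> 0" by simp
    moreover have "((\<lambda>\<tau>. exp (- \<bar>\<nu>\<bar> * \<tau>) * d \<tau>) has_real_derivative
        exp (- \<bar>\<nu>\<bar> * \<tau>) * (\<nu> * (sin (y \<tau>) - sin (x \<tau>)) + (b - a) - \<bar>\<nu>\<bar> * d \<tau>)) (at \<tau>)"
      using d by (auto intro!: derivative_eq_intros simp: algebra_simps)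
    ultimately show "\<exists>y. ((\<lambda>\<tau>. exp (- \<bar>\<nu>\<bar> * \<tau>) * d \<tau>) has_real_derivative y) (at \<tau>) \<and> 0 \<le> y" by blast
  qed (use \<open>t0 < t\<close> cd in \<open>auto intro!: continuous_intros\<close>)
  moreover have "exp (- \<bar>\<nu>\<bar> * t0) * d t0 \<ge> 0" using t0 by (simp add: S_def)
  moreover have "exp (- \<bar>\<nu>\<bar> * t) * d t < 0"
    using \<open>\<not> x t \<le> y t\<close> by (simp add: d_def mult_pos_neg)
  ultimately show False by linarith
qed

text \<open>A Gronwall estimate: the difference is nonnegative by order preservation, so its
  derivative is at most \<bar>\<nu>\<bar> times itself plus \<open>b - a\<close>.\<close>

lemma solves_lift_lipschitz_param:
  assumes x: "solves_lift \<nu> a s x" and y: "solves_lift \<nu> b s y"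
    and "a \<le> b" "x 0 = y 0" "0 \<le> t"
  shows "y t - x t \<le> (b - a) * t * exp (\<bar>\<nu>\<bar> * t)"
proof -
  define d where "d \<tau> = y \<tau> - x \<tau>" for \<tau>
  have d: "(d has_real_derivative \<nu> * (sin (y \<tau>) - sin (x \<tau>)) + (b - a)) (at \<tau>)" for \<tau>
    using x y unfolding d_def solves_lift_def
    by (auto intro!: derivative_eq_intros simp: algebra_simps)
  have "exp (- \<bar>\<nu>\<bar> * t) * d t - (b - a) * t \<le> exp (- \<bar>\<nu>\<bar> * 0) * d 0 - (b - a) * 0"
  proof (rule DERIV_nonpos_imp_nonincreasing[OF \<open>0 \<le> t\<close>])
    fix \<tau> assume \<tau>: "0 \<le> \<tau>" "\<tau> \<le> t"
    have "d \<tau> \<ge> 0" using solves_lift_mono[OF x y \<open>a \<le> b\<close> _ \<tau>(1)] assms by (simp add: d_def)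
    have "\<bar>\<nu> * (sin (y \<tau>) - sin (x \<tau>))\<bar> \<le> \<bar>\<nu>\<bar> * \<bar>d \<tau>\<bar>"
      unfolding abs_mult d_def by (intro mult_left_mono sin_lipschitz) auto
    then have "\<nu> * (sin (y \<tau>) - sin (x \<tau>)) + (b - a) - \<bar>\<nu>\<bar> * d \<tau> \<le> b - a"
      using \<open>d \<tau> \<ge> 0\<close> by simp
    then have "exp (- \<bar>\<nu>\<bar> * \<tau>) * (\<nu> * (sin (y \<tau>) - sin (x \<tau>)) + (b - a) - \<bar>\<nu>\<bar> * d \<tau>)
        \<le> exp (- \<bar>\<nu>\<bar> * \<tau>) * (b - a)" by simp
    also have "\<dots> \<le> 1 * (b - a)" using \<tau> \<open>a \<le> b\<close> by (intro mult_right_mono) auto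
    finally have "exp (- \<bar>\<nu>\<bar> * \<tau>) * (\<nu> * (sin (y \<tau>) - sin (x \<tau>)) + (b - a) - \<bar>\<nu>\<bar> * d \<tau>) - (b - a) \<le> 0"
      by simp
    moreover have "((\<lambda>\<tau>. exp (- \<bar>\<nu>\<bar> * \<tau>) * d \<tau> - (b - a) * \<tau>) has_real_derivative
        exp (- \<bar>\<nu>\<bar> * \<tau>) * (\<nu> * (sin (y \<tau>) - sin (x \<tau>)) + (b - a) - \<bar>\<nu>\<bar> * d \<tau>) - (b - a)) (at \<tau>)"
      using d by (auto intro!: derivative_eq_intros simp: algebra_simps)
    ultimately show "\<exists>y. ((\<lambda>\<tau>. exp (- \<bar>\<nu>\<bar> * \<tau>) * d \<tau> - (b - a) * \<tau>) has_real_derivative y) (at \<tau>) \<and> y \<le> 0"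
      by blast
  qed
  then have "exp (- \<bar>\<nu>\<bar> * t) * d t \<le> (b - a) * t" using assms by (simp add: d_def)
  then have "exp (\<bar>\<nu>\<bar> * t) * (exp (- \<bar>\<nu>\<bar> * t) * d t) \<le> exp (\<bar>\<nu>\<bar> * t) * ((b - a) * t)" by simp
  then show ?thesis by (simp add: d_def mult_ac flip: mult.assoc exp_add)
qed

text \<open>Removing the terms that integrate explicitly leaves a function with derivative \<nu> sin
  x. At whole periods the cosine term disappears.\<close>

lemma solves_lift_drift:
  assumes x: "solves_lift \<nu> a s x" and "0 \<le> t"
  shows "\<bar>x t - x 0 - a * t + s * (cos t - 1)\<bar> \<le> \<bar>\<nu>\<bar> * t"
proof -
  define y where "y \<tau> = x \<tau> - a * \<tau> + s * cos \<tau>" for \<tau>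
  have "norm (y t - y 0) \<le> \<bar>\<nu>\<bar> * norm (t - 0)"
  proof (rule field_differentiable_bound[OF convex_UNIV])
    show "(y has_real_derivative \<nu> * sin (x \<tau>)) (at \<tau> within UNIV)" for \<tau>
      using x unfolding y_def solves_lift_def by (auto intro!: derivative_eq_intros)
  qed (auto simp: abs_mult mult_left_le)
  then show ?thesis using \<open>0 \<le> t\<close> by (simp add: y_def algebra_simps)
qed

subsection \<open>The rotation number and the period map\<close>

lemma quasi_additive_bound:
  fixes A :: "nat \<Rightarrow> real"
  assumes A: "\<And>m n. \<bar>A (m + n) - A m - A n\<bar> \<le> C"
  shows "\<bar>A (m * n) - real m * A n\<bar> \<le> C * (real m + 1)"
proof (induction m)
  case 0
  have "\<bar>A 0\<bar> \<le> C" using A[of 0 0] by simp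
  then show ?case by simp
next
  case (Suc m)
  have "\<bar>A (n + m * n) - A n - A (m * n)\<bar> \<le> C" by (rule A)
  with Suc show ?case by (simp add: algebra_simps)
qed

text \<open>Both \<open>A m / m\<close> and \<open>A n / n\<close> are close to
  \<open>A (m * n) / (m * n)\<close>, so they differ by at most
  \<open>2 * C / m + 2 * C / n\<close>, and the quotients form a Cauchy sequence.\<close>

lemma quasi_additive_convergent:
  fixes A :: "nat \<Rightarrow> real"
  assumes A: "\<And>m n. \<bar>A (m + n) - A m - A n\<bar> \<le> C"
  shows "convergent (\<lambda>n. A n / real n)"
proof -
  have "C \<ge> 0" using A[of 0 0] by linarith
  have one: "\<bar>A (m * n) / real (m * n) - A n / real n\<bar> \<le> 2 * C / real n" if "m > 0" "n > 0" for m n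
  proof -
    have "\<bar>A (m * n) - real m * A n\<bar> \<le> C * (real m + 1)" by (rule quasi_additive_bound[of A C m n, OF A])
    also have "\<dots> \<le> C * (2 * real m)" using \<open>C \<ge> 0\<close> that by (intro mult_left_mono) auto
    finally have "\<bar>A (m * n) - real m * A n\<bar> / real (m * n) \<le> C * (2 * real m) / real (m * n)"
      by (rule divide_right_mono) simp
    moreover have "A (m * n) / real (m * n) - A n / real n = (A (m * n) - real m * A n) / real (m * n)"
      using that by (simp add: field_simps)
    ultimately show ?thesis using that by (simp add: abs_divide field_simps)
  qed
  have two: "\<bar>A m / real m - A n / real n\<bar> \<le> 2 * C / real m + 2 * C / real n" if "m > 0" "n > 0" for m n
    using one[OF that] one[OF that(2,1)] by (simp add: mult.commute)
  have "Cauchy (\<lambda>n. A n / real n)"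
  proof (rule metric_CauchyI)
    fix e :: real assume "e > 0"
    obtain N :: nat where N: "real N > 4 * C / e" using reals_Archimedean2 by blast
    have *: "2 * C / real m < e / 2" if "m \<ge> Suc N" for m
    proof -
      have "4 * C / e < real m" using N that by simp
      then show ?thesis using that \<open>e > 0\<close> by (simp add: field_simps)
    qed
    show "\<exists>M. \<forall>m\<ge>M. \<forall>n\<ge>M. dist (A m / real m) (A n / real n) < e"
    proof (intro exI allI impI)
      fix m n assume "m \<ge> Suc N" "n \<ge> Suc N"
      then show "dist (A m / real m) (A n / real n) < e"
        using two[of m n] *[of m] *[of n] by (simp add: dist_real_def)
    qed
  qed
  then show ?thesis by (simp add: Cauchy_convergent_iff)
qed

text \<open>The translates of \<open>x\<close> by multiples of \<open>2 * pi\<close> are solutions.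
  Initially \<open>y\<close> lies between two consecutive ones, and order preservation keeps it
  there.\<close>

lemma solves_lift_sandwich:
  assumes x: "solves_lift \<nu> a s x" and y: "solves_lift \<nu> a s y"
  obtains k :: int where "\<And>t. t \<ge> 0 \<Longrightarrow> x t + 2 * pi * of_int k \<le> y t"
    "\<And>t. t \<ge> 0 \<Longrightarrow> y t \<le> x t + 2 * pi * of_int k + 2 * pi"
proof
  define k where "k = \<lfloor>(y 0 - x 0) / (2 * pi)\<rfloor>"
  have k: "of_int k \<le> (y 0 - x 0) / (2 * pi)" "(y 0 - x 0) / (2 * pi) < of_int k + 1"
    unfolding k_def by linarith+
  have "2 * pi * of_int k \<le> y 0 - x 0" "y 0 - x 0 \<le> 2 * pi * of_int (k + 1)"
    using k by (simp_all add: field_simps)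
  then show "x t + 2 * pi * of_int k \<le> y t" "y t \<le> x t + 2 * pi * of_int k + 2 * pi" if "t \<ge> 0" for t
    using solves_lift_mono[OF solves_lift_add_int[OF x, of k] y _ _ that]
      solves_lift_mono[OF y solves_lift_add_int[OF x, of "k + 1"] _ _ that]
    by (auto simp: algebra_simps)
qed

text \<open>Compare \<open>x\<close> with its own shift by \<open>m\<close> periods: their
  difference stays in an interval of length \<open>2 * pi\<close>, so displacements over whole
  periods are additive up to \<open>2 * pi\<close>.\<close>

lemma rotation_limit_exists:
  assumes x: "solves_lift \<nu> a s x"
  shows "convergent (\<lambda>n. (x (2 * pi * real n) - x 0) / (2 * pi * real n))"
proof -
  have "\<bar>(x (2 * pi * real (m + n)) - x 0) - (x (2 * pi * real m) - x 0) - (x (2 * pi * real n) - x 0)\<bar> \<le> 2 * pi"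
    for m n
  proof -
    obtain k :: int where
      k: "\<And>t. t \<ge> 0 \<Longrightarrow> x t + 2 * pi * of_int k \<le> x (t + 2 * pi * real m)"
         "\<And>t. t \<ge> 0 \<Longrightarrow> x (t + 2 * pi * real m) \<le> x t + 2 * pi * of_int k + 2 * pi"
      using solves_lift_sandwich[OF x solves_lift_shift_time[OF x, of m]] by blast
    show ?thesis using k(1)[of 0] k(2)[of 0] k(1)[of "2 * pi * real n"] k(2)[of "2 * pi * real n"]
      by (simp add: algebra_simps)
  qed
  from quasi_additive_convergent[of "\<lambda>n. x (2 * pi * real n) - x 0", OF this]
  have "convergent (\<lambda>n. 1 / (2 * pi) * ((x (2 * pi * real n) - x 0) / real n))"
    by (rule convergent_mult[OF convergent_const])
  then show ?thesis by (simp add: mult_ac)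
qed

lemma rotation_limit_unique:
  assumes x: "solves_lift \<nu> a s x" and y: "solves_lift \<nu> a s y"
    and lim: "(\<lambda>n. (x (2 * pi * real n) - x 0) / (2 * pi * real n)) \<longlonglongrightarrow> \<rho>"
  shows "(\<lambda>n. (y (2 * pi * real n) - y 0) / (2 * pi * real n)) \<longlonglongrightarrow> \<rho>"
proof -
  obtain k :: int where k: "\<And>t. t \<ge> 0 \<Longrightarrow> x t + 2 * pi * of_int k \<le> y t"
         "\<And>t. t \<ge> 0 \<Longrightarrow> y t \<le> x t + 2 * pi * of_int k + 2 * pi"
    using solves_lift_sandwich[OF x y] by blast
  have bd: "\<bar>(y (2 * pi * real n) - y 0) - (x (2 * pi * real n) - x 0)\<bar> \<le> 2 * pi" for n
    using k(1)[of 0] k(2)[of 0] k(1)[of "2 * pi * real n"] k(2)[of "2 * pi * real n"] by simp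
  have "(\<lambda>n. (y (2 * pi * real n) - y 0) / (2 * pi * real n) - (x (2 * pi * real n) - x 0) / (2 * pi * real n))
      \<longlonglongrightarrow> 0"
  proof (rule Lim_null_comparison[OF _ lim_inverse_n], intro always_eventually allI)
    fix n
    have "\<bar>(y (2 * pi * real n) - y 0) - (x (2 * pi * real n) - x 0)\<bar> / (2 * pi * real n)
        \<le> 2 * pi / (2 * pi * real n)" by (rule divide_right_mono[OF bd]) simp
    then show "norm ((y (2 * pi * real n) - y 0) / (2 * pi * real n) - (x (2 * pi * real n) - x 0) / (2 * pi * real n))
        \<le> inverse (real n)"
      by (simp add: abs_divide abs_mult field_simps flip: diff_divide_distrib)
  qed
  from tendsto_add[OF this lim] show ?thesis by simp
qed

text \<open>The limit is the same for all solutions, so \<rho> satisfies the definite description.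
  The given solution \<open>x\<close> keeps its quantifier from being vacuous and yields
  uniqueness.\<close>

lemma rotation_number_eqI:
  assumes x: "solves_lift \<nu> a s x"
    and lim: "(\<lambda>n. (x (2 * pi * real n) - x 0) / (2 * pi * real n)) \<longlonglongrightarrow> \<rho>"
  shows "rotation_number \<nu> a s = \<rho>"
  unfolding rotation_number_def
proof (rule the_equality)
  show "\<forall>x. solves_lift \<nu> a s x \<longrightarrow> (\<lambda>n. (x (2 * pi * real n) - x 0) / (2 * pi * real n)) \<longlonglongrightarrow> \<rho>"
    using rotation_limit_unique[OF x _ lim] by blast
  show "\<sigma> = \<rho>" if "\<forall>x. solves_lift \<nu> a s x \<longrightarrow>
      (\<lambda>n. (x (2 * pi * real n) - x 0) / (2 * pi * real n)) \<longlonglongrightarrow> \<sigma>" for \<sigma>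
    using that x lim LIMSEQ_unique by blast
qed

lemma rotation_number_limit:
  assumes x: "solves_lift \<nu> a s x"
  shows "(\<lambda>n. (x (2 * pi * real n) - x 0) / (2 * pi * real n)) \<longlonglongrightarrow> rotation_number \<nu> a s"
proof -
  obtain \<rho> where \<rho>: "(\<lambda>n. (x (2 * pi * real n) - x 0) / (2 * pi * real n)) \<longlonglongrightarrow> \<rho>"
    using rotation_limit_exists[OF x] by (auto simp: convergent_def)
  then show ?thesis using rotation_number_eqI[OF x \<rho>] by simp
qed

lemma rotation_number_le:
  assumes x: "solves_lift \<nu> a s x" and bd: "\<And>n. x (2 * pi * real n) - x 0 \<le> c * (2 * pi * real n)"
  shows "rotation_number \<nu> a s \<le> c"
proof -
  \<comment> \<open>At \<open>n = 0\<close> the quotient is a division by zero with value 0, which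
    need not be below \<open>c\<close>; the limit only sees \<open>n \<ge> 1\<close>.\<close>
  have "(x (2 * pi * real n) - x 0) / (2 * pi * real n) \<le> c" if "n \<ge> 1" for n
  proof -
    have "0 < 2 * pi * real n" using that by simp
    from pos_divide_le_eq[OF this] bd[of n] show ?thesis by blast
  qed
  then show ?thesis using LIMSEQ_le_const2[OF rotation_number_limit[OF x]] by blast
qed

lemma rotation_number_ge:
  assumes x: "solves_lift \<nu> a s x" and bd: "\<And>n. c * (2 * pi * real n) \<le> x (2 * pi * real n) - x 0"
  shows "c \<le> rotation_number \<nu> a s"
proof -
  have "c \<le> (x (2 * pi * real n) - x 0) / (2 * pi * real n)" if "n \<ge> 1" for n
  proof -
    have "0 < 2 * pi * real n" using that by simp
    from pos_le_divide_eq[OF this] bd[of n] show ?thesis by blast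
  qed
  then show ?thesis using LIMSEQ_le_const[OF rotation_number_limit[OF x]] by blast
qed

text \<open>This confines each slice of a tongue to a bounded interval, so that its infimum and
  supremum are meaningful, and it bounds \<open>a\<close> in terms of \<open>r\<close>
  alone.\<close>

lemma rotation_number_near: "\<bar>rotation_number \<nu> a s - a\<bar> \<le> \<bar>\<nu>\<bar>"
proof -
  obtain x where x: "solves_lift \<nu> a s x" using solves_lift_exists by blast
  have cos: "cos (2 * pi * real n) = 1" for n using cos.plus_of_nat[of "0::real" n] by (simp add: mult_ac)
  have bd: "\<bar>x (2 * pi * real n) - x 0 - a * (2 * pi * real n)\<bar> \<le> \<bar>\<nu>\<bar> * (2 * pi * real n)" for n
    using solves_lift_drift[OF x, of "2 * pi * real n"] by (simp add: cos)
  have "rotation_number \<nu> a s \<le> a + \<bar>\<nu>\<bar>"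
  proof (rule rotation_number_le[OF x])
    show "x (2 * pi * real n) - x 0 \<le> (a + \<bar>\<nu>\<bar>) * (2 * pi * real n)" for n
      using abs_le_D1[OF bd[of n]] by (simp add: algebra_simps)
  qed
  moreover have "a - \<bar>\<nu>\<bar> \<le> rotation_number \<nu> a s"
  proof (rule rotation_number_ge[OF x])
    show "(a - \<bar>\<nu>\<bar>) * (2 * pi * real n) \<le> x (2 * pi * real n) - x 0" for n
      using abs_le_D2[OF bd[of n]] by (simp add: algebra_simps)
  qed
  ultimately show ?thesis by linarith
qed

lemma rotation_number_mono:
  assumes "a \<le> b"
  shows "rotation_number \<nu> a s \<le> rotation_number \<nu> b s"
proof -
  obtain x where x: "solves_lift \<nu> a s x" "x 0 = 0" using solves_lift_exists by blast
  obtain y where y: "solves_lift \<nu> b s y" "y 0 = 0" using solves_lift_exists by blast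
  have le: "x (2 * pi * real n) - x 0 \<le> y (2 * pi * real n) - y 0" for n
      using solves_lift_mono[OF x(1) y(1) assms, of "2 * pi * real n"] x(2) y(2) by simp
  have "(x (2 * pi * real n) - x 0) / (2 * pi * real n) \<le> (y (2 * pi * real n) - y 0) / (2 * pi * real n)" for n
    by (rule divide_right_mono[OF le]) simp
  then show ?thesis
    using LIMSEQ_le[OF rotation_number_limit[OF x(1)] rotation_number_limit[OF y(1)]] by blast
qed

text \<open>The translate of \<open>x\<close> by \<open>2 * pi * r\<close> and the shift of
  \<open>x\<close> by one period are solutions ordered at time 0, hence at all later times. The
  advance therefore repeats in every period.\<close>

lemma rotation_number_ge_int:
  assumes x: "solves_lift \<nu> a s x" and "x (2 * pi) \<ge> x 0 + 2 * pi * of_int r"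
  shows "of_int r \<le> rotation_number \<nu> a s"
proof (rule rotation_number_ge[OF x])
  have step: "x (t + 2 * pi) \<ge> x t + 2 * pi * of_int r" if "t \<ge> 0" for t
    using solves_lift_mono[OF solves_lift_add_int[OF x, of r] solves_lift_shift_time[OF x, of 1] _ _ that]
      assms by simp
  show "of_int r * (2 * pi * real n) \<le> x (2 * pi * real n) - x 0" for n
  proof (induction n)
    case (Suc n)
    then show ?case using step[of "2 * pi * real n"] by (simp add: algebra_simps)
  qed simp
qed

lemma rotation_number_le_int:
  assumes x: "solves_lift \<nu> a s x" and "x (2 * pi) \<le> x 0 + 2 * pi * of_int r"
  shows "rotation_number \<nu> a s \<le> of_int r"
proof (rule rotation_number_le[OF x])
  have step: "x (t + 2 * pi) \<le> x t + 2 * pi * of_int r" if "t \<ge> 0" for t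
    using solves_lift_mono[OF solves_lift_shift_time[OF x, of 1] solves_lift_add_int[OF x, of r] _ _ that]
      assms by simp
  show "x (2 * pi * real n) - x 0 \<le> of_int r * (2 * pi * real n)" for n
  proof (induction n)
    case (Suc n)
    then show ?case using step[of "2 * pi * real n"] by (simp add: algebra_simps)
  qed simp
qed

text \<open>The endpoint \<open>X a (2 * pi)\<close> is continuous in \<open>a\<close> and crosses
  \<open>2 * pi * r\<close> between \<open>r - \<bar>\<nu>\<bar>\<close> and
  \<open>r + \<bar>\<nu>\<bar>\<close>. A solution advancing by exactly \<open>2 * pi * r\<close> in
  one period forces rotation number \<open>r\<close>.\<close>

lemma tongue_slice_nonempty: "tongue_slice \<nu> (of_int r) s \<noteq> {}"
proof -
  have "\<exists>X. \<forall>a. solves_lift \<nu> a s (X a) \<and> X a 0 = 0" by (intro choice allI solves_lift_exists)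
  then obtain X where X: "\<And>a. solves_lift \<nu> a s (X a)" "\<And>a. X a 0 = 0" by blast
  define E where "E = 2 * pi * exp (\<bar>\<nu>\<bar> * (2 * pi))"
  have "E > 0" by (simp add: E_def)
  have lip: "\<bar>X a (2 * pi) - X b (2 * pi)\<bar> \<le> E * \<bar>a - b\<bar>" for a b
  proof -
    have "\<bar>X a (2 * pi) - X b (2 * pi)\<bar> \<le> E * \<bar>a - b\<bar>" if "a \<le> b" for a b
      using solves_lift_mono[OF X(1) X(1) that, of "2 * pi"]
        solves_lift_lipschitz_param[OF X(1) X(1) that, of "2 * pi"] X(2) that
      by (simp add: E_def algebra_simps)
    from this[of a b] this[of b a] show ?thesis by (cases "a \<le> b") (auto simp: abs_minus_commute)
  qed
  have "continuous_on A (\<lambda>a. X a (2 * pi))" for A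
    by (rule lipschitz_on_continuous_on[of E])
       (use lip \<open>E > 0\<close> in \<open>auto simp: lipschitz_on_def dist_real_def\<close>)
  moreover have bd: "\<bar>X a (2 * pi) - 2 * pi * a\<bar> \<le> 2 * pi * \<bar>\<nu>\<bar>" for a
    using solves_lift_drift[OF X(1), of "2 * pi" a] X(2) by (simp add: mult_ac)
  have "X (of_int r - \<bar>\<nu>\<bar>) (2 * pi) \<le> 2 * pi * of_int r" "2 * pi * of_int r \<le> X (of_int r + \<bar>\<nu>\<bar>) (2 * pi)"
    using bd[of "of_int r - \<bar>\<nu>\<bar>"] bd[of "of_int r + \<bar>\<nu>\<bar>"] by (simp_all add: algebra_simps abs_le_iff)
  ultimately obtain a where "X a (2 * pi) = 2 * pi * of_int r"
    using IVT'[of "\<lambda>a. X a (2 * pi)" "of_int r - \<bar>\<nu>\<bar>" "2 * pi * of_int r" "of_int r + \<bar>\<nu>\<bar>"] by auto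
  then have "rotation_number \<nu> a s = of_int r"
    using rotation_number_ge_int[OF X(1), of a r] rotation_number_le_int[OF X(1), of a r] X(2) by auto
  then show ?thesis by (auto simp: tongue_slice_def arnold_tongue_def)
qed

text \<open>The slice is bounded and nonempty, so equality of its \<open>Inf\<close> and
  \<open>Sup\<close> really makes it a singleton; for other sets these values would carry no
  information.\<close>

lemma adjacency_tongue_slice:
  assumes "is_adjacency \<nu> (of_int r) (a, s)"
  shows "tongue_slice \<nu> (of_int r) s = {a}"
proof -
  have "\<bar>b - of_int r\<bar> \<le> \<bar>\<nu>\<bar>" if "b \<in> tongue_slice \<nu> (of_int r) s" for b
    using that rotation_number_near[of \<nu> b s] by (simp add: tongue_slice_def arnold_tongue_def)
  then have "tongue_slice \<nu> (of_int r) s \<subseteq> {of_int r - \<bar>\<nu>\<bar>..of_int r + \<bar>\<nu>\<bar>}"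
    by (force simp: abs_le_iff)
  then have "bdd_below (tongue_slice \<nu> (of_int r) s)" "bdd_above (tongue_slice \<nu> (of_int r) s)"
    by (meson bdd_below_Icc bdd_above_Icc bdd_below_mono bdd_above_mono)+
  then have "b = a" if "b \<in> tongue_slice \<nu> (of_int r) s" for b
    using cInf_lower[OF that] cSup_upper[OF that] assms
    by (simp add: is_adjacency_def left_boundary_def right_boundary_def)
  then show ?thesis using tongue_slice_nonempty[of \<nu> r s] by auto
qed

lemma adjacency_period_map:
  assumes adj: "is_adjacency \<nu> (of_int r) (a, s)" and x: "solves_lift \<nu> a s x"
  shows "x (2 * pi) = x 0 + 2 * pi * of_int r"
proof -
  have iff: "rotation_number \<nu> b s = of_int r \<longleftrightarrow> b = a" for b
    using adjacency_tongue_slice[OF adj] by (auto simp: tongue_slice_def arnold_tongue_def set_eq_iff)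
  define E where "E = 2 * pi * exp (\<bar>\<nu>\<bar> * (2 * pi))"
  have "E > 0" by (simp add: E_def)
  show ?thesis
  proof (rule linorder_cases)
    assume gt: "x 0 + 2 * pi * of_int r < x (2 * pi)"
    \<comment> \<open>\<open>E\<close> is a Lipschitz constant of the endpoint in \<open>a\<close>,
      so lowering \<open>a\<close> by this amount loses at most the excess. The rotation number
      stays at least \<open>r\<close>, and by monotonicity at most \<open>r\<close>.\<close>
    define \<epsilon> where "\<epsilon> = (x (2 * pi) - (x 0 + 2 * pi * of_int r)) / E"
    have "\<epsilon> > 0" using gt \<open>E > 0\<close> by (simp add: \<epsilon>_def)
    obtain y where y: "solves_lift \<nu> (a - \<epsilon>) s y" "y 0 = x 0" using solves_lift_exists by blast
    have "x (2 * pi) - y (2 * pi) \<le> \<epsilon> * E"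
      using solves_lift_lipschitz_param[OF y(1) x _ y(2), of "2 * pi"] \<open>\<epsilon> > 0\<close> by (simp add: E_def mult_ac)
    then have "y (2 * pi) \<ge> y 0 + 2 * pi * of_int r" using \<open>E > 0\<close> y(2) by (simp add: \<epsilon>_def)
    then have "of_int r \<le> rotation_number \<nu> (a - \<epsilon>) s" by (rule rotation_number_ge_int[OF y(1)])
    then have "rotation_number \<nu> (a - \<epsilon>) s = of_int r"
      using rotation_number_mono[of "a - \<epsilon>" a \<nu> s] iff[of a] \<open>\<epsilon> > 0\<close> by simp
    then show ?thesis using iff[of "a - \<epsilon>"] \<open>\<epsilon> > 0\<close> by simp
  next
    assume lt: "x (2 * pi) < x 0 + 2 * pi * of_int r"
    define \<epsilon> where "\<epsilon> = (x 0 + 2 * pi * of_int r - x (2 * pi)) / E"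
    have "\<epsilon> > 0" using lt \<open>E > 0\<close> by (simp add: \<epsilon>_def)
    obtain y where y: "solves_lift \<nu> (a + \<epsilon>) s y" "y 0 = x 0" using solves_lift_exists by blast
    have "y (2 * pi) - x (2 * pi) \<le> \<epsilon> * E"
      using solves_lift_lipschitz_param[OF x y(1) _ y(2)[symmetric], of "2 * pi"] \<open>\<epsilon> > 0\<close>
      by (simp add: E_def mult_ac)
    then have "y (2 * pi) \<le> y 0 + 2 * pi * of_int r" using \<open>E > 0\<close> y(2) by (simp add: \<epsilon>_def)
    then have "rotation_number \<nu> (a + \<epsilon>) s \<le> of_int r" by (rule rotation_number_le_int[OF y(1)])
    then have "rotation_number \<nu> (a + \<epsilon>) s = of_int r"
      using rotation_number_mono[of a "a + \<epsilon>" \<nu> s] iff[of a] \<open>\<epsilon> > 0\<close> by simp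
    then show ?thesis using iff[of "a + \<epsilon>"] \<open>\<epsilon> > 0\<close> by simp
  qed simp
qed

subsection \<open>Completeness of the exponentials\<close>

text \<open>A real linear function of \<open>cis t\<close> combines \<open>cis t\<close> and
  \<open>cis (- t)\<close>, which only shift the frequency \<open>k\<close>. Since \<open>h\<close>
  is arbitrary in the induction, a product is handled by applying the second hypothesis to
  \<open>h\<close> times the first factor.\<close>

lemma polynomial_times_vanishing_moments:
  fixes h :: "real \<Rightarrow> complex"
  assumes "real_polynomial_function p"
    and "\<And>k::int. ((\<lambda>t. h t * cis (of_int k * t)) has_integral 0) A"
  shows "((\<lambda>t. h t * of_real (p (cis t)) * cis (of_int k * t)) has_integral 0) A"
  using assms
proof (induction arbitrary: h k)
  case (linear p)
  interpret p: bounded_linear p by fact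
  have p: "p (cis t) = cos t * p 1 + sin t * p \<i>" for t
  proof -
    have "cis t = cos t *\<^sub>R 1 + sin t *\<^sub>R \<i>" by (simp add: complex_eq_iff)
    then show ?thesis by (simp add: p.add p.scaleR)
  qed
  define a b where "a = (of_real (p 1) - \<i> * of_real (p \<i>)) / 2" and "b = (of_real (p 1) + \<i> * of_real (p \<i>)) / 2"
  have e: "cis (of_int (k + 1) * t) = cis (of_int k * t) * cis t"
    "cis (of_int (k - 1) * t) = cis (of_int k * t) * cis (- t)" for t
    by (simp_all add: cis_mult algebra_simps)
  have "of_real (p (cis t)) = a * cis t + b * cis (- t)" for t
    by (simp add: p a_def b_def complex_eq_iff algebra_simps add_divide_distrib diff_divide_distrib)
  then have "h t * of_real (p (cis t)) * cis (of_int k * t)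
      = a * (h t * cis (of_int (k + 1) * t)) + b * (h t * cis (of_int (k - 1) * t))" for t
    by (simp only: e) (simp add: algebra_simps)
  moreover have "((\<lambda>t. a * (h t * cis (of_int (k + 1) * t)) + b * (h t * cis (of_int (k - 1) * t)))
      has_integral a * 0 + b * 0) A"
    by (intro has_integral_add has_integral_mult_right linear)
  ultimately show ?case by simp
next
  case (const c)
  have "((\<lambda>t. of_real c * (h t * cis (of_int k * t))) has_integral of_real c * 0) A"
    by (intro has_integral_mult_right const)
  then show ?case by (simp add: mult_ac)
next
  case (add f g)
  have "((\<lambda>t. h t * of_real (f (cis t)) * cis (of_int k * t) + h t * of_real (g (cis t)) * cis (of_int k * t))
      has_integral 0 + 0) A"
    by (intro has_integral_add add)
  then show ?case by (simp add: algebra_simps)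
next
  case (mult f g)
  show ?case
    using mult.IH(2)[OF mult.IH(1)[OF mult.prems]] by (simp add: mult_ac)
qed

text \<open>\<open>Arg2pi\<close> jumps at 1, so continuity cannot come from composition. Instead
  \<open>cis\<close> is a quotient map from the compact interval onto the circle, and continuity of
  \<open>g\<close> descends along it.\<close>

lemma circle_lift_continuous:
  fixes g :: "real \<Rightarrow> complex"
  assumes cont: "continuous_on {0..2*pi} g" and per: "g (2 * pi) = g 0"
  obtains F where "continuous_on (sphere 0 1) F" "\<And>t. t \<in> {0..2*pi} \<Longrightarrow> F (cis t) = g t"
proof
  define F where "F z = g (Arg2pi z)" for z
  show F: "F (cis t) = g t" if "t \<in> {0..2*pi}" for t
  proof (cases "t = 2 * pi")
    case True
    then show ?thesis using per Arg2pi_of_real[of 1] by (simp add: F_def cis_2pi)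
  next
    case False
    then have "Arg2pi (cis t) = t"
      using that by (intro Arg2pi_unique[of 1]) (auto simp: cis_conv_exp)
    then show ?thesis by (simp add: F_def)
  qed
  have img: "cis ` {0..2*pi} = sphere 0 1"
  proof
    show "sphere 0 1 \<subseteq> cis ` {0..2*pi}"
    proof
      fix z :: complex assume "z \<in> sphere 0 1"
      then have "z = cis (Arg2pi z)" using Arg2pi_eq[of z] by (simp add: cis_conv_exp)
      moreover have "Arg2pi z \<in> {0..2*pi}" using Arg2pi[of z] by auto
      ultimately show "z \<in> cis ` {0..2*pi}" by blast
    qed
  qed auto
  have cc: "continuous_on {0..2*pi} cis" by (intro continuous_intros)
  show "continuous_on (sphere 0 1) F"
  proof (subst continuous_openin_preimage_eq, intro allI impI)
    fix V :: "complex set" assume "open V"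
    have "{0..2*pi} \<inter> cis -` (sphere 0 1 \<inter> F -` V) = {0..2*pi} \<inter> g -` V"
      using F by auto
    moreover have "openin (top_of_set {0..2*pi}) ({0..2*pi} \<inter> g -` V)"
      using cont \<open>open V\<close> by (simp add: continuous_openin_preimage_gen)
    ultimately show "openin (top_of_set (sphere 0 1)) (sphere 0 1 \<inter> F -` V)"
      using Abstract_Topology_2.continuous_imp_quotient_map[OF cc img, of "sphere 0 1 \<inter> F -` V"] by auto
  qed
qed

text \<open>By Stone-Weierstrass, \<open>g\<close> is uniformly close to a polynomial
  \<open>p\<close> in \<open>cis t\<close>. Since \<open>g\<close> is orthogonal to
  \<open>p\<close>, the integral of \<open>\<bar>g\<bar>\<close> squared equals that of
  \<open>g * cnj (g - p)\<close>, which is arbitrarily small.\<close>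

lemma vanishing_moments_imp_zero:
  fixes g :: "real \<Rightarrow> complex"
  assumes cont: "continuous_on {0..2*pi} g" and per: "g (2 * pi) = g 0"
    and mom: "\<And>k::int. ((\<lambda>t. g t * cis (of_int k * t)) has_integral 0) {0..2*pi}"
    and t: "t \<in> {0..2*pi}"
  shows "g t = 0"
proof -
  obtain F where F: "continuous_on (sphere 0 1) F" "\<And>t. t \<in> {0..2*pi} \<Longrightarrow> F (cis t) = g t"
    using circle_lift_continuous[OF cont per] by blast
  have "compact (g ` {0..2*pi})" using cont by (simp add: compact_continuous_image)
  then obtain B where B: "B > 0" "\<And>t. t \<in> {0..2*pi} \<Longrightarrow> norm (g t) \<le> B"
    using compact_imp_bounded bounded_pos by (metis imageI)
  define N where "N = integral {0..2*pi} (\<lambda>t. (norm (g t))\<^sup>2)"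
  have N: "((\<lambda>t. (norm (g t))\<^sup>2) has_integral N) {0..2*pi}"
    unfolding N_def
    by (intro integrable_integral integrable_continuous_interval continuous_intros cont)
  then have "((\<lambda>t. of_real ((norm (g t))\<^sup>2) :: complex) has_integral of_real N) {0..2*pi}"
    by (rule has_integral_of_real)
  then have gg: "((\<lambda>t. g t * cnj (g t)) has_integral of_real N) {0..2*pi}"
    by (simp add: complex_norm_square del: of_real_power)
  have "\<bar>N\<bar> \<le> e" if "e > 0" for e
  proof -
    \<comment> \<open>Chosen so that the integrand bound \<open>B * d\<close> times the interval
      length \<open>2 * pi\<close> is exactly \<open>e\<close>.\<close>
    define d where "d = e / (2 * pi * B)"
    have "d > 0" using that B by (simp add: d_def)
    obtain p where p: "polynomial_function p" "\<And>z. z \<in> sphere 0 1 \<Longrightarrow> norm (F z - p z) < d"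
      using Stone_Weierstrass_polynomial_function[OF compact_sphere F(1) \<open>d > 0\<close>] by blast
    have rp: "real_polynomial_function (\<lambda>z. Re (p z))" "real_polynomial_function (\<lambda>z. Im (p z))"
      using p(1) bounded_linear_Re bounded_linear_Im by (auto simp: polynomial_function_def o_def)
    have "((\<lambda>t. g t * of_real (Re (p (cis t))) * cis (of_int 0 * t)
        - \<i> * (g t * of_real (Im (p (cis t))) * cis (of_int 0 * t))) has_integral 0 - \<i> * 0) {0..2*pi}"
      by (intro has_integral_diff has_integral_mult_right polynomial_times_vanishing_moments rp mom)
    moreover have "g t * of_real (Re (p (cis t))) - \<i> * (g t * of_real (Im (p (cis t))))
        = g t * cnj (p (cis t))" for t
      by (simp add: complex_eq_iff)
    ultimately have "((\<lambda>t. g t * cnj (p (cis t))) has_integral 0) {0..2*pi}" by simp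
    from has_integral_diff[OF gg this]
    have "((\<lambda>t. g t * cnj (g t - p (cis t))) has_integral of_real N) (cbox 0 (2*pi))"
      by (simp add: algebra_simps)
    then have "norm (of_real N :: complex) \<le> B * d * measure lborel (cbox 0 (2 * pi))"
    proof (rule has_integral_bound[rotated])
      fix t assume "t \<in> cbox 0 (2 * pi)"
      then have t: "t \<in> {0..2*pi}" by simp
      have "norm (g t - p (cis t)) \<le> d" using p(2)[of "cis t"] F(2)[OF t] by simp
      then show "norm (g t * cnj (g t - p (cis t))) \<le> B * d"
        unfolding norm_mult complex_mod_cnj using B(2)[OF t] B(1) by (intro mult_mono) auto
    qed (use B \<open>d > 0\<close> in simp)
    also have "\<dots> = e" using B by (simp add: d_def)
    finally show ?thesis by simp
  qed
  then have "N = 0" by (metis abs_ge_zero abs_zero dense_ge linorder_not_le nle_le abs_le_zero_iff)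
  then have "integral (cbox 0 (2*pi)) (\<lambda>t. (norm (g t))\<^sup>2) = 0" by (simp add: N_def)
  then have "(norm (g t))\<^sup>2 = 0"
    using t by (subst (asm) integral_cbox_eq_0_iff) (auto intro!: continuous_intros cont simp: pi_gt_zero[folded not_le])
  then show ?thesis by simp
qed

subsection \<open>Three-term recurrences\<close>

text \<open>The coefficient of the \<open>k - 1\<close> term is 1, so one step of the recurrence
  only flips the sign of the Casoratian \<open>W\<close>. Its constant modulus must equal its limit
  0.\<close>

lemma casoratian_vanishes:
  fixes D E :: "int \<Rightarrow> complex"
  assumes D: "\<And>k. D (k + 1) = D (k - 1) + c k * D k" and E: "\<And>k. E (k + 1) = E (k - 1) + c k * E k"
    and limD: "(\<lambda>n. D (int n)) \<longlonglongrightarrow> 0" and limE: "(\<lambda>n. E (int n)) \<longlonglongrightarrow> 0"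
  shows "D k * E (k + 1) = D (k + 1) * E k"
proof -
  define W where "W k = D k * E (k + 1) - D (k + 1) * E k" for k
  have step: "norm (W (k + 1)) = norm (W k)" for k
  proof -
    have "W (k + 1) = - W k" using D[of "k + 1"] E[of "k + 1"] by (simp add: W_def algebra_simps)
    then show ?thesis by simp
  qed
  have const: "norm (W k) = norm (W 0)" for k
  proof (induction k rule: int_induct[of _ 0])
    case (step2 i)
    then show ?case using step[of "i - 1"] by simp
  qed (simp_all add: step)
  have lim1: "(\<lambda>n. f (int n + 1)) \<longlonglongrightarrow> 0" if "(\<lambda>n. f (int n)) \<longlonglongrightarrow> 0" for f :: "int \<Rightarrow> complex"
    using LIMSEQ_Suc[OF that] by (simp add: add.commute)
  have "(\<lambda>n. W (int n)) \<longlonglongrightarrow> 0 * 0 - 0 * 0"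
    unfolding W_def by (intro tendsto_intros limD limE lim1)
  then have "(\<lambda>n. norm (W (int n))) \<longlonglongrightarrow> 0" by (simp add: tendsto_norm_zero)
  moreover have "(\<lambda>n. norm (W (int n))) = (\<lambda>n. norm (W 0))" by (rule ext) (rule const)
  ultimately have "(\<lambda>n::nat. norm (W 0)) \<longlonglongrightarrow> 0" by (simp only:)
  then have "norm (W 0) = 0" by (simp add: LIMSEQ_const_iff)
  then have "W k = 0" using const[of k] by simp
  then show ?thesis by (simp add: W_def)
qed

lemma three_term_zero:
  fixes F :: "int \<Rightarrow> complex"
  assumes F: "\<And>k. F (k + 1) = F (k - 1) + c k * F k" and "F 0 = 0" "F 1 = 0"
  shows "F k = 0"
proof -
  have "F k = 0 \<and> F (k + 1) = 0"
  proof (induction k rule: int_induct[of _ 0])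
    case (step1 i)
    then show ?case using F[of "i + 1"] by simp
  next
    case (step2 i)
    then show ?case using F[of i] by (metis add.right_neutral diff_add_cancel mult_zero_right)
  qed (use assms in simp)
  then show ?thesis by simp
qed

text \<open>The vanishing Casoratian makes the initial pairs at 0 and 1 linearly dependent; the
  recurrence carries the dependence to all indices in both directions.\<close>

lemma decaying_solutions_dependent:
  fixes D E :: "int \<Rightarrow> complex"
  assumes D: "\<And>k. D (k + 1) = D (k - 1) + c k * D k" and E: "\<And>k. E (k + 1) = E (k - 1) + c k * E k"
    and limD: "(\<lambda>n. D (int n)) \<longlonglongrightarrow> 0" and limE: "(\<lambda>n. E (int n)) \<longlonglongrightarrow> 0"
  obtains p q where "p \<noteq> 0 \<or> q \<noteq> 0" "\<And>k. p * D k + q * E k = 0"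
proof -
  have W: "D 0 * E 1 = D 1 * E 0" using casoratian_vanishes[OF D E limD limE, of 0] by simp
  obtain p q where pq: "p \<noteq> 0 \<or> q \<noteq> 0" "p * D 0 + q * E 0 = 0" "p * D 1 + q * E 1 = 0"
  proof (cases "D 0 = 0 \<and> D 1 = 0")
    case True
    then show thesis using that[of 1 0] by simp
  next
    case False
    then consider "D 0 \<noteq> 0" | "D 1 \<noteq> 0" by blast
    then show thesis
      by cases (use that[of "E 0" "- D 0"] that[of "E 1" "- D 1"] W in \<open>simp_all add: algebra_simps\<close>)
  qed
  have "p * D k + q * E k = 0" for k
    by (rule three_term_zero[where F = "\<lambda>k. p * D k + q * E k" and c = c])
       (use D E pq in \<open>simp_all add: algebra_simps\<close>)
  with pq show thesis using that by blast
qed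

subsection \<open>The linear system\<close>

text \<open>The quotient \<open>w = u / v\<close> satisfies the Riccati equation
  \<open>w' = \<nu> / 2 * (w^2 - 1) + \<i> * (a + s * sin t) * w\<close>, which is the original
  equation written for \<open>w = cis x\<close>.\<close>

definition linear_lift :: "real \<Rightarrow> real \<Rightarrow> real \<Rightarrow> (real \<Rightarrow> complex) \<Rightarrow> (real \<Rightarrow> complex) \<Rightarrow> bool" where
  "linear_lift \<nu> a s u v \<longleftrightarrow>
     (\<forall>t. (v has_vector_derivative - of_real (\<nu> / 2) * u t) (at t) \<and>
          (u has_vector_derivative - of_real (\<nu> / 2) * v t + \<i> * of_real (a + s * sin t) * u t) (at t))"

lemma cis_has_vector_derivative:
  assumes "(x has_real_derivative d) (at t)"
  shows "((\<lambda>t. cis (x t)) has_vector_derivative \<i> * d * cis (x t)) (at t)"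
proof -
  have "((\<lambda>t. \<i> * of_real (x t)) has_vector_derivative \<i> * of_real d) (at t)"
    by (intro derivative_intros has_vector_derivative_of_real) (use assms in \<open>simp add: has_real_derivative_iff_has_vector_derivative\<close>)
  from field_vector_diff_chain_at[OF this DERIV_exp] show ?thesis
    by (simp add: o_def cis_conv_exp)
qed

text \<open>With \<open>u = cis x * v\<close> the equation for \<open>v\<close> is scalar and is
  solved by an exponential, here \<open>exp (P t)\<close>. The equation for \<open>u\<close> then
  follows from \<open>2 * \<i> * sin x * cis x = cis x * cis x - 1\<close>.\<close>

lemma linear_lift_of_solution:
  assumes x: "solves_lift \<nu> a s x"
  obtains v where "linear_lift \<nu> a s (\<lambda>t. cis (x t) * v t) v" "v 0 = 1"
proof -
  have "continuous_on UNIV (\<lambda>t. - of_real (\<nu> / 2) * cis (x t))"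
    by (intro continuous_intros solves_lift_continuous[OF x])
  then obtain P where P: "P 0 = 0" "\<And>t. (P has_vector_derivative - of_real (\<nu> / 2) * cis (x t)) (at t)"
    using antiderivative_exists by blast
  have v: "((\<lambda>t. exp (P t)) has_vector_derivative - of_real (\<nu> / 2) * (cis (x t) * exp (P t))) (at t)" for t
    using field_vector_diff_chain_at[OF P(2)[of t] DERIV_exp] by (simp add: o_def mult_ac)
  have c: "((\<lambda>t. cis (x t)) has_vector_derivative \<i> * of_real (\<nu> * sin (x t) + a + s * sin t) * cis (x t)) (at t)" for t
    using cis_has_vector_derivative[of x "\<nu> * sin (x t) + a + s * sin t" t] x
    by (simp add: solves_lift_def)
  have eq: "\<i> * of_real (sin (x t)) * cis (x t) = (cis (x t) * cis (x t) - 1) / 2" for t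
    using sin_cos_squared_add[of "x t"]
    by (simp add: complex_eq_iff power2_eq_square) 
  have "((\<lambda>t. cis (x t) * exp (P t)) has_vector_derivative
      - of_real (\<nu> / 2) * exp (P t) + \<i> * of_real (a + s * sin t) * (cis (x t) * exp (P t))) (at t)" for t
  proof -
    have "((\<lambda>t. cis (x t) * exp (P t)) has_vector_derivative
      cis (x t) * (- of_real (\<nu> / 2) * (cis (x t) * exp (P t))) + \<i> * of_real (\<nu> * sin (x t) + a + s * sin t) * cis (x t) * exp (P t)) (at t)"
      by (rule has_vector_derivative_mult[OF c v])
    moreover have "cis (x t) * (- of_real (\<nu> / 2) * (cis (x t) * exp (P t))) + \<i> * of_real (\<nu> * sin (x t) + a + s * sin t) * cis (x t) * exp (P t)
       = - of_real (\<nu> / 2) * (cis (x t) * cis (x t) - 2 * (\<i> * of_real (sin (x t)) * cis (x t))) * exp (P t)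
         + \<i> * of_real (a + s * sin t) * (cis (x t) * exp (P t))"
      by (simp add: algebra_simps)
    moreover have "- of_real (\<nu> / 2) * (cis (x t) * cis (x t) - 2 * ((cis (x t) * cis (x t) - 1) / 2)) * exp (P t)
       = - of_real (\<nu> / 2) * exp (P t)" by (simp add: field_simps)
    ultimately show ?thesis by (simp only: eq)
  qed
  then show thesis using that[of "\<lambda>t. exp (P t)"] v P(1) by (simp add: linear_lift_def)
qed

lemma linear_lift_lincomb:
  assumes "linear_lift \<nu> a s u1 v1" "linear_lift \<nu> a s u2 v2"
  shows "linear_lift \<nu> a s (\<lambda>t. p * u1 t + q * u2 t) (\<lambda>t. p * v1 t + q * v2 t)"
  unfolding linear_lift_def
proof (intro allI conjI)
  fix t
  have *: "((\<lambda>t. p * f t + q * g t) has_vector_derivative p * f' + q * g') (at t)"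
    if "(f has_vector_derivative f') (at t)" "(g has_vector_derivative g') (at t)"
    for f g :: "real \<Rightarrow> complex" and f' g'
    using that by (auto intro!: derivative_eq_intros)
  show "((\<lambda>t. p * v1 t + q * v2 t) has_vector_derivative - of_real (\<nu> / 2) * (p * u1 t + q * u2 t)) (at t)"
    using *[of v1 "- of_real (\<nu> / 2) * u1 t" v2 "- of_real (\<nu> / 2) * u2 t"] assms
    by (simp add: linear_lift_def algebra_simps)
  show "((\<lambda>t. p * u1 t + q * u2 t) has_vector_derivative
     - of_real (\<nu> / 2) * (p * v1 t + q * v2 t) + \<i> * of_real (a + s * sin t) * (p * u1 t + q * u2 t)) (at t)"
    using *[of u1 "- of_real (\<nu> / 2) * v1 t + \<i> * of_real (a + s * sin t) * u1 t" u2 "- of_real (\<nu> / 2) * v2 t + \<i> * of_real (a + s * sin t) * u2 t"] assms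
    by (simp add: linear_lift_def algebra_simps)
qed

lemma linear_lift_continuous:
  assumes "linear_lift \<nu> a s u v"
  shows "continuous_on A u" "continuous_on A v"
  using assms unfolding linear_lift_def
  by (meson continuous_at_imp_continuous_on has_vector_derivative_continuous)+

text \<open>Liouville's formula: the trace of the system is \<open>i (a + s sin t)\<close>.\<close>

lemma linear_lift_wronskian:
  assumes "linear_lift \<nu> a s u1 v1" "linear_lift \<nu> a s u2 v2"
  shows "u1 (2 * pi) * v2 (2 * pi) - u2 (2 * pi) * v1 (2 * pi) = cis (2 * pi * a) * (u1 0 * v2 0 - u2 0 * v1 0)"
proof -
  \<comment> \<open>Up to a constant, \<theta> is minus the antiderivative of
    \<open>a + s * sin t\<close>; the factor \<open>cis (\<theta> t)\<close> cancels the trace, so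
    \<open>q\<close> is constant.\<close>
  define \<theta> where "\<theta> t = - a * t + s * cos t" for t
  define q where "q t = (u1 t * v2 t - u2 t * v1 t) * cis (\<theta> t)" for t
  have \<theta>: "(\<theta> has_real_derivative - (a + s * sin t)) (at t)" for t
    unfolding \<theta>_def by (auto intro!: derivative_eq_intros)
  have "(q has_vector_derivative 0) (at t)" for t
  proof -
    have d: "(v1 has_vector_derivative - of_real (\<nu> / 2) * u1 t) (at t)"
      "(u1 has_vector_derivative - of_real (\<nu> / 2) * v1 t + \<i> * of_real (a + s * sin t) * u1 t) (at t)"
      "(v2 has_vector_derivative - of_real (\<nu> / 2) * u2 t) (at t)"
      "(u2 has_vector_derivative - of_real (\<nu> / 2) * v2 t + \<i> * of_real (a + s * sin t) * u2 t) (at t)"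
      using assms by (auto simp: linear_lift_def)
    show ?thesis unfolding q_def
      by (rule has_vector_derivative_eq_rhs)
         (rule has_vector_derivative_mult has_vector_derivative_diff cis_has_vector_derivative \<theta> d
           | simp add: algebra_simps)+
  qed
  then have "q (2 * pi) = q 0"
    using has_vector_derivative_zero_constant[of UNIV q] by (metis UNIV_I convex_UNIV)
  moreover have "cis (\<theta> (2 * pi)) = cis (\<theta> 0) * cis (- (2 * pi * a))"
    by (simp add: \<theta>_def cis_mult algebra_simps)
  ultimately have "(u1 (2 * pi) * v2 (2 * pi) - u2 (2 * pi) * v1 (2 * pi)) * cis (- (2 * pi * a)) = u1 0 * v2 0 - u2 0 * v1 0"
    by (simp add: q_def)
  then have "(u1 (2 * pi) * v2 (2 * pi) - u2 (2 * pi) * v1 (2 * pi)) * (cis (- (2 * pi * a)) * cis (2 * pi * a))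
      = cis (2 * pi * a) * (u1 0 * v2 0 - u2 0 * v1 0)" by (simp add: mult_ac)
  then show ?thesis by (simp add: cis_mult)
qed

text \<open>The frequency is real, to accommodate quasi-periodic functions:
  \<open>fourier f (k - \<mu>)\<close> is \<open>2 * pi\<close> times the Fourier coefficient of
  index \<open>- k\<close> of \<open>cis (- \<mu> * t) * f t\<close>.\<close>

definition fourier :: "(real \<Rightarrow> complex) \<Rightarrow> real \<Rightarrow> complex" where
  "fourier f \<kappa> = integral {0..2*pi} (\<lambda>t. f t * cis (\<kappa> * t))"

lemma fourier_has_integral:
  assumes "continuous_on {0..2*pi} f"
  shows "((\<lambda>t. f t * cis (\<kappa> * t)) has_integral fourier f \<kappa>) {0..2*pi}"
  unfolding fourier_def
  by (intro integrable_integral integrable_continuous_interval continuous_intros assms)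

text \<open>Integration by parts; the hypothesis on \<open>f (2 * pi)\<close> says exactly that the
  boundary terms cancel.\<close>

lemma fourier_derivative:
  assumes f: "\<And>t. (f has_vector_derivative f' t) (at t)"
    and cont: "continuous_on {0..2*pi} f'" and bdry: "f (2 * pi) * cis (2 * pi * \<kappa>) = f 0"
  shows "fourier f' \<kappa> = - \<i> * of_real \<kappa> * fourier f \<kappa>"
proof -
  have contf: "continuous_on {0..2*pi} f"
    using f by (meson continuous_at_imp_continuous_on has_vector_derivative_continuous)
  have "((\<lambda>t. f t * cis (\<kappa> * t)) has_vector_derivative f t * (\<i> * of_real \<kappa> * cis (\<kappa> * t)) + f' t * cis (\<kappa> * t)) (at t)" for t
    by (intro has_vector_derivative_mult f cis_has_vector_derivative) (auto intro!: derivative_eq_intros)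
  then have "((\<lambda>t. f t * (\<i> * of_real \<kappa> * cis (\<kappa> * t)) + f' t * cis (\<kappa> * t)) has_integral
      f (2 * pi) * cis (\<kappa> * (2 * pi)) - f 0 * cis (\<kappa> * 0)) {0..2*pi}"
    by (intro fundamental_theorem_of_calculus) (auto intro: has_vector_derivative_at_within)
  then have "((\<lambda>t. \<i> * of_real \<kappa> * (f t * cis (\<kappa> * t)) + f' t * cis (\<kappa> * t)) has_integral 0) {0..2*pi}"
    using bdry by (simp add: mult_ac)
  moreover have "((\<lambda>t. \<i> * of_real \<kappa> * (f t * cis (\<kappa> * t)) + f' t * cis (\<kappa> * t)) has_integral
      \<i> * of_real \<kappa> * fourier f \<kappa> + fourier f' \<kappa>) {0..2*pi}"
    by (intro has_integral_add has_integral_mult_right fourier_has_integral contf cont)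
  ultimately have "\<i> * of_real \<kappa> * fourier f \<kappa> + fourier f' \<kappa> = 0" using has_integral_unique by blast
  then show ?thesis by (simp add: eq_neg_iff_add_eq_0 add.commute)
qed

text \<open>Transforming the first equation expresses \<open>fourier v \<kappa>\<close> through
  \<open>fourier u \<kappa>\<close>. In the second, multiplication by \<open>sin t\<close> shifts
  the frequency by 1 both ways, leaving a three-term recurrence for \<open>u\<close> alone. The last
  conclusion yields decay, as its left side is bounded in \<kappa>.\<close>

lemma
  assumes L: "linear_lift \<nu> a s u v"
    and bdry: "u (2 * pi) * cis (2 * pi * \<kappa>) = u 0" "v (2 * pi) * cis (2 * pi * \<kappa>) = v 0"
    and "\<kappa> \<noteq> 0" "s \<noteq> 0"
  shows linear_lift_fourier_snd: "fourier v \<kappa> = of_real \<nu> / (2 * \<i> * of_real \<kappa>) * fourier u \<kappa>"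
    and linear_lift_fourier_rec: "fourier u (\<kappa> + 1) = fourier u (\<kappa> - 1)
          + 2 / of_real s * (of_real \<nu> ^ 2 / (4 * \<i> * of_real \<kappa>) - \<i> * of_real (\<kappa> + a)) * fourier u \<kappa>"
    and linear_lift_fourier_decay: "fourier (\<lambda>t. - of_real (\<nu> / 2) * v t + \<i> * of_real (a + s * sin t) * u t) \<kappa> = - \<i> * of_real \<kappa> * fourier u \<kappa>"
proof -
  note c = linear_lift_continuous[OF L]
  have "fourier (\<lambda>t. - of_real (\<nu> / 2) * u t) \<kappa> = - \<i> * of_real \<kappa> * fourier v \<kappa>"
    by (rule fourier_derivative) (use L bdry in \<open>auto simp: linear_lift_def intro!: continuous_intros c\<close>)
  moreover have "fourier (\<lambda>t. - of_real (\<nu> / 2) * u t) \<kappa> = - of_real (\<nu> / 2) * fourier u \<kappa>"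
    unfolding fourier_def by (simp only: mult.assoc integral_mult_right)
  ultimately show v: "fourier v \<kappa> = of_real \<nu> / (2 * \<i> * of_real \<kappa>) * fourier u \<kappa>"
    using \<open>\<kappa> \<noteq> 0\<close> by (simp add: field_simps)
  show d: "fourier (\<lambda>t. - of_real (\<nu> / 2) * v t + \<i> * of_real (a + s * sin t) * u t) \<kappa> = - \<i> * of_real \<kappa> * fourier u \<kappa>"
    by (rule fourier_derivative) (use L bdry in \<open>auto simp: linear_lift_def intro!: continuous_intros c\<close>)
  have cis_succ: "cis ((\<kappa> + 1) * t) = cis ((\<kappa> - 1) * t) + 2 * (\<i> * of_real (sin t) * cis (\<kappa> * t))" for t
    by (simp add: complex_eq_iff ring_distribs cos_add sin_add cos_diff sin_diff)
  have e: "(- of_real (\<nu> / 2) * v t + \<i> * of_real (a + s * sin t) * u t) * cis (\<kappa> * t)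
      = - of_real (\<nu> / 2) * (v t * cis (\<kappa> * t)) + \<i> * of_real a * (u t * cis (\<kappa> * t))
        + (of_real s / 2 * (u t * cis ((\<kappa> + 1) * t)) - of_real s / 2 * (u t * cis ((\<kappa> - 1) * t)))" for t
    unfolding cis_succ by (simp add: field_simps)
  have "((\<lambda>t. (- of_real (\<nu> / 2) * v t + \<i> * of_real (a + s * sin t) * u t) * cis (\<kappa> * t)) has_integral
      - of_real (\<nu> / 2) * fourier v \<kappa> + \<i> * of_real a * fourier u \<kappa>
        + (of_real s / 2 * fourier u (\<kappa> + 1) - of_real s / 2 * fourier u (\<kappa> - 1))) {0..2*pi}"
    unfolding e
    by (intro has_integral_add has_integral_diff has_integral_mult_right fourier_has_integral c)
  then have "fourier (\<lambda>t. - of_real (\<nu> / 2) * v t + \<i> * of_real (a + s * sin t) * u t) \<kappa> =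
      - of_real (\<nu> / 2) * fourier v \<kappa> + \<i> * of_real a * fourier u \<kappa>
        + (of_real s / 2 * fourier u (\<kappa> + 1) - of_real s / 2 * fourier u (\<kappa> - 1))"
    unfolding fourier_def by (rule integral_unique)
  then have "- \<i> * of_real \<kappa> * fourier u \<kappa> = - of_real (\<nu> / 2) * (of_real \<nu> / (2 * \<i> * of_real \<kappa>) * fourier u \<kappa>) + \<i> * of_real a * fourier u \<kappa>
        + (of_real s / 2 * fourier u (\<kappa> + 1) - of_real s / 2 * fourier u (\<kappa> - 1))"
    unfolding d v .
  then show "fourier u (\<kappa> + 1) = fourier u (\<kappa> - 1)
          + 2 / of_real s * (of_real \<nu> ^ 2 / (4 * \<i> * of_real \<kappa>) - \<i> * of_real (\<kappa> + a)) * fourier u \<kappa>"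
    using \<open>\<kappa> \<noteq> 0\<close> \<open>s \<noteq> 0\<close> by (simp add: field_simps power2_eq_square)
qed

text \<open>The transform of \<open>u'\<close> is bounded uniformly in the frequency \<kappa> and
  equals \<open>- \<i> * \<kappa>\<close> times that of \<open>u\<close>, so the latter is of order
  \<open>1 / \<bar>\<kappa>\<bar>\<close>. Non-integrality of \<mu> ensures that \<kappa> is never
  0.\<close>

lemma linear_lift_fourier_tendsto_zero:
  assumes L: "linear_lift \<nu> a s u v"
    and bdry: "u (2 * pi) = cis (2 * pi * \<mu>) * u 0" "v (2 * pi) = cis (2 * pi * \<mu>) * v 0"
    and "\<mu> \<notin> \<int>" "s \<noteq> 0"
  shows "(\<lambda>n. fourier u (of_int (int n) - \<mu>)) \<longlonglongrightarrow> 0"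
proof -
  define u' where "u' t = - of_real (\<nu> / 2) * v t + \<i> * of_real (a + s * sin t) * u t" for t
  have cu': "continuous_on {0..2*pi} u'"
    unfolding u'_def by (intro continuous_intros linear_lift_continuous[OF L])
  then have "compact (u' ` {0..2*pi})" by (simp add: compact_continuous_image)
  then obtain B where B: "B > 0" "\<And>t. t \<in> {0..2*pi} \<Longrightarrow> norm (u' t) \<le> B"
    using compact_imp_bounded bounded_pos by (metis imageI)
  have bd: "norm (fourier u' \<kappa>) \<le> B * (2 * pi - 0)" for \<kappa>
    unfolding fourier_def
    by (rule integral_bound) (use B in \<open>auto simp: norm_mult intro!: continuous_intros cu'\<close>)
  have "filterlim (\<lambda>n. - \<mu> + real n) at_top sequentially"
    by (rule filterlim_tendsto_add_at_top[OF tendsto_const filterlim_real_sequentially])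
  then have "(\<lambda>n. B * (2 * pi) / (- \<mu> + real n)) \<longlonglongrightarrow> 0"
    by (rule real_tendsto_divide_at_top[OF tendsto_const])
  then have "(\<lambda>n. \<bar>B * (2 * pi) / (- \<mu> + real n)\<bar>) \<longlonglongrightarrow> 0"
    by (rule tendsto_rabs_zero)
  then have lim: "(\<lambda>n. B * (2 * pi) / \<bar>real n - \<mu>\<bar>) \<longlonglongrightarrow> 0"
    using B(1) by (simp add: abs_divide abs_mult)
  show ?thesis
  proof (rule Lim_null_comparison[OF _ lim], intro always_eventually allI)
    fix n
    define \<kappa> where "\<kappa> = of_int (int n) - \<mu>"
    have "\<kappa> \<noteq> 0"
      using \<open>\<mu> \<notin> \<int>\<close> Ints_of_int[of "int n"] unfolding \<kappa>_def by (metis eq_iff_diff_eq_0)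
    have "cis (2 * pi * \<mu>) * cis (2 * pi * \<kappa>) = 1"
      using cis_multiple_2pi[of "int n"] by (simp add: \<kappa>_def cis_mult algebra_simps)
    then have "u (2 * pi) * cis (2 * pi * \<kappa>) = u 0" "v (2 * pi) * cis (2 * pi * \<kappa>) = v 0"
      unfolding bdry by (simp_all add: mult_ac mult.left_commute)
    from linear_lift_fourier_decay[OF L this \<open>\<kappa> \<noteq> 0\<close> \<open>s \<noteq> 0\<close>]
    have "fourier u' \<kappa> = - \<i> * \<kappa> * fourier u \<kappa>" by (simp add: u'_def[abs_def])
    then have "\<bar>\<kappa>\<bar> * norm (fourier u \<kappa>) \<le> B * (2 * pi)"
      using bd[of \<kappa>] by (simp add: norm_mult)
    then have "norm (fourier u \<kappa>) \<le> B * (2 * pi) / \<bar>\<kappa>\<bar>"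
      using \<open>\<kappa> \<noteq> 0\<close> by (simp add: field_simps)
    then show "norm (fourier u (of_int (int n) - \<mu>)) \<le> B * (2 * pi) / \<bar>real n - \<mu>\<bar>"
      by (simp add: \<kappa>_def)
  qed
qed

text \<open>Multiplying by \<open>cis (- (\<mu> * t))\<close> makes \<open>f\<close> periodic with
  all moments zero, so completeness of the exponentials applies.\<close>

lemma quasi_periodic_zero:
  assumes cont: "continuous_on {0..2*pi} f" and bdry: "f (2 * pi) = cis (2 * pi * \<mu>) * f 0"
    and zero: "\<And>k::int. fourier f (of_int k - \<mu>) = 0"
  shows "f 0 = 0"
proof -
  define g where "g t = f t * cis (- (\<mu> * t))" for t
  have "g 0 = 0"
  proof (rule vanishing_moments_imp_zero)
    show "continuous_on {0..2*pi} g" unfolding g_def by (intro continuous_intros cont)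
    have "cis (2 * pi * \<mu>) * cis (- (\<mu> * (2 * pi))) = 1" by (simp add: cis_mult)
    then show "g (2 * pi) = g 0" by (simp add: g_def bdry)
    show "((\<lambda>t. g t * cis (of_int k * t)) has_integral 0) {0..2*pi}" for k :: int
    proof -
      have "g t * cis (of_int k * t) = f t * cis ((of_int k - \<mu>) * t)" for t
        by (simp add: g_def mult.assoc cis_mult algebra_simps)
      then show ?thesis using fourier_has_integral[OF cont, of "of_int k - \<mu>"] zero[of k] by simp
    qed
  qed simp
  then show ?thesis by (simp add: g_def)
qed

text \<open>With a common multiplier, the Fourier sequences of \<open>u1\<close> and
  \<open>u2\<close> are decaying solutions of one recurrence. Hence a nontrivial combination of the
  two solutions has all coefficients zero, vanishes at 0, and makes the initial vectors
  parallel.\<close>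

lemma quasi_periodic_solutions_dependent:
  assumes L1: "linear_lift \<nu> a s u1 v1" and L2: "linear_lift \<nu> a s u2 v2"
    and b1: "u1 (2 * pi) = cis (2 * pi * \<mu>) * u1 0" "v1 (2 * pi) = cis (2 * pi * \<mu>) * v1 0"
    and b2: "u2 (2 * pi) = cis (2 * pi * \<mu>) * u2 0" "v2 (2 * pi) = cis (2 * pi * \<mu>) * v2 0"
    and \<mu>: "\<mu> \<notin> \<int>" and s: "s \<noteq> 0"
  shows "u1 0 * v2 0 = u2 0 * v1 0"
proof -
  have nz: "of_int k - \<mu> \<noteq> 0" for k :: int
    using \<mu> Ints_of_int[of k] by (metis eq_iff_diff_eq_0)
  have bdry: "f (2 * pi) * cis (2 * pi * (of_int k - \<mu>)) = f 0"
    if "f (2 * pi) = cis (2 * pi * \<mu>) * f 0" for f :: "real \<Rightarrow> complex" and k :: int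
  proof -
    have "cis (2 * pi * \<mu>) * cis (2 * pi * (of_int k - \<mu>)) = 1"
      using cis_multiple_2pi[of "of_int k"] by (simp add: cis_mult algebra_simps)
    then show ?thesis unfolding that by (simp add: mult_ac mult.left_commute)
  qed
  have rec: "fourier u (of_int (k + 1) - \<mu>) = fourier u (of_int (k - 1) - \<mu>)
        + 2 / of_real s * (of_real \<nu> ^ 2 / (4 * \<i> * of_real (of_int k - \<mu>)) - \<i> * of_real (of_int k - \<mu> + a)) * fourier u (of_int k - \<mu>)"
    if "linear_lift \<nu> a s u v" "u (2 * pi) = cis (2 * pi * \<mu>) * u 0" "v (2 * pi) = cis (2 * pi * \<mu>) * v 0"
    for u v and k :: int
    using linear_lift_fourier_rec[OF that(1) bdry[OF that(2)] bdry[OF that(3)] nz s, of k]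
    by (simp add: algebra_simps)
  obtain p q where pq: "p \<noteq> 0 \<or> q \<noteq> 0"
    and z: "\<And>k::int. p * fourier u1 (of_int k - \<mu>) + q * fourier u2 (of_int k - \<mu>) = 0"
    using decaying_solutions_dependent[where D = "\<lambda>k. fourier u1 (of_int k - \<mu>)" and E = "\<lambda>k. fourier u2 (of_int k - \<mu>)",
        OF rec[OF L1 b1] rec[OF L2 b2] linear_lift_fourier_tendsto_zero[OF L1 b1 \<mu> s]
          linear_lift_fourier_tendsto_zero[OF L2 b2 \<mu> s]] by blast
  define u where "u t = p * u1 t + q * u2 t" for t
  define v where "v t = p * v1 t + q * v2 t" for t
  have L: "linear_lift \<nu> a s u v"
    unfolding u_def v_def by (rule linear_lift_lincomb[OF L1 L2])
  have b: "u (2 * pi) = cis (2 * pi * \<mu>) * u 0" "v (2 * pi) = cis (2 * pi * \<mu>) * v 0"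
    unfolding u_def v_def b1 b2 by (simp_all add: algebra_simps)
  have u0: "fourier u (of_int k - \<mu>) = 0" for k :: int
  proof -
    have "((\<lambda>t. p * (u1 t * cis ((of_int k - \<mu>) * t)) + q * (u2 t * cis ((of_int k - \<mu>) * t))) has_integral
        p * fourier u1 (of_int k - \<mu>) + q * fourier u2 (of_int k - \<mu>)) {0..2*pi}"
      by (intro has_integral_add has_integral_mult_right fourier_has_integral
          linear_lift_continuous[OF L1] linear_lift_continuous[OF L2])
    then have "((\<lambda>t. u t * cis ((of_int k - \<mu>) * t)) has_integral 0) {0..2*pi}"
      unfolding z u_def by (simp add: ring_distribs mult.assoc)
    then show ?thesis unfolding fourier_def by (rule integral_unique)
  qed
  have v0: "fourier v (of_int k - \<mu>) = 0" for k :: int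
    using linear_lift_fourier_snd[OF L bdry[OF b(1)] bdry[OF b(2)] nz s, of k] u0[of k] by simp
  have "u 0 = 0" by (rule quasi_periodic_zero[OF linear_lift_continuous(1)[OF L] b(1) u0])
  moreover have "v 0 = 0" by (rule quasi_periodic_zero[OF linear_lift_continuous(2)[OF L] b(2) v0])
  ultimately have uv: "p * u1 0 + q * u2 0 = 0" "p * v1 0 + q * v2 0 = 0"
    by (simp_all add: u_def v_def)
  \<comment> \<open>Cramer's rule: the determinant times \<open>p\<close> or \<open>q\<close> is a
    combination of the two vanishing expressions in \<open>uv\<close>.\<close>
  have "p * (u1 0 * v2 0 - u2 0 * v1 0) = (p * u1 0 + q * u2 0) * v2 0 - (p * v1 0 + q * v2 0) * u2 0"
    "q * (u1 0 * v2 0 - u2 0 * v1 0) = (p * v1 0 + q * v2 0) * u1 0 - (p * u1 0 + q * u2 0) * v1 0"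
    by (simp_all add: algebra_simps)
  then have "p * (u1 0 * v2 0 - u2 0 * v1 0) = 0" "q * (u1 0 * v2 0 - u2 0 * v1 0) = 0"
    unfolding uv by simp_all
  then show ?thesis using pq by auto
qed

lemma identity_period_map_imp_int:
  assumes s: "s \<noteq> 0"
    and id: "\<And>x. solves_lift \<nu> a s x \<Longrightarrow> x (2 * pi) = x 0 + 2 * pi * of_int r"
  shows "a \<in> \<int>"
proof (rule ccontr)
  assume a: "a \<notin> \<int>"
  have "\<exists>u v. linear_lift \<nu> a s u v \<and> u 0 = cis c \<and> v 0 = 1 \<and> u (2 * pi) = v (2 * pi) * cis c" for c
  proof -
    obtain x where x: "solves_lift \<nu> a s x" "x 0 = c" using solves_lift_exists by blast
    obtain v where v: "linear_lift \<nu> a s (\<lambda>t. cis (x t) * v t) v" "v 0 = 1"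
      using linear_lift_of_solution[OF x(1)] by blast
    have "cis (x (2 * pi)) = cis c"
      using id[OF x(1)] x(2) cis_multiple_2pi[of "of_int r"] by (simp flip: cis_mult)
    then show ?thesis using v x(2) by (intro exI[of _ "\<lambda>t. cis (x t) * v t"] exI[of _ v]) simp
  qed
  then obtain u v where L: "\<And>c. linear_lift \<nu> a s (u c) (v c)" and u0: "\<And>c. u c 0 = cis c"
    and v0: "\<And>c. v c 0 = 1" and u2: "\<And>c. u c (2 * pi) = v c (2 * pi) * cis c"
    by metis
  \<comment> \<open>\<open>Lam c\<close> is the eigenvalue of the monodromy on the initial vector
    \<open>(cis c, 1)\<close>.\<close>
  define Lam where "Lam c = v c (2 * pi)" for c
  \<comment> \<open>The angles are taken in \<open>[0, 2]\<close>, inside \<open>[0, pi]\<close>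
    where the cosine is injective.\<close>
  have ne: "cis b \<noteq> cis c" if "0 \<le> b" "b \<le> 2" "0 \<le> c" "c \<le> 2" "b \<noteq> c" for b c
    using cos_inj_pi[of b c] that pi_gt3 by (auto simp: complex_eq_iff)
  have W: "Lam b * Lam c = cis (2 * pi * a)" if "0 \<le> b" "b \<le> 2" "0 \<le> c" "c \<le> 2" "b \<noteq> c" for b c
  proof -
    have "Lam b * Lam c * (cis b - cis c) = cis (2 * pi * a) * (cis b - cis c)"
      using linear_lift_wronskian[OF L[of b] L[of c], unfolded u0 v0 u2, folded Lam_def]
      by (simp add: algebra_simps)
    then show ?thesis using ne[OF that] by simp
  qed
  \<comment> \<open>A planar linear map with three distinct eigendirections is scalar. The angles 0,
    1, 2 supply the three directions, and the third one is used to cancel.\<close>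
  have "Lam 0 * Lam 2 = Lam 1 * Lam 2" "Lam 2 \<noteq> 0"
    using W[of 0 2] W[of 1 2] by auto
  then have Lam01: "Lam 1 = Lam 0" by simp
  then have "(Lam 0)\<^sup>2 = (cis (pi * a))\<^sup>2"
    using W[of 0 1] by (simp add: power2_eq_square cis_mult mult.assoc)
  then consider "Lam 0 = cis (pi * a)" | "Lam 0 = cis (pi * a + pi)"
    by (auto simp: power2_eq_iff minus_cis)
  \<comment> \<open>The two square roots correspond to exponents \<open>a / 2\<close> and
    \<open>(a + 1) / 2\<close>; either being an integer would make \<open>a\<close> an
    integer.\<close>
  then obtain \<mu> where \<mu>: "Lam 0 = cis (2 * pi * \<mu>)" "2 * \<mu> = a \<or> 2 * \<mu> = a + 1"
  proof cases
    case 1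
    then show thesis using that[of "a / 2"] by simp
  next
    case 2
    moreover have "2 * pi * ((a + 1) / 2) = pi * a + pi" by (simp add: field_simps)
    ultimately have "Lam 0 = cis (2 * pi * ((a + 1) / 2))" by (simp only:)
    then show thesis using that[of "(a + 1) / 2"] by simp
  qed
  have "\<mu> \<notin> \<int>"
  proof
    assume "\<mu> \<in> \<int>"
    then have "2 * \<mu> \<in> \<int>" "2 * \<mu> - 1 \<in> \<int>" by auto
    then show False using a \<mu>(2) by auto
  qed
  then have "u 0 0 * v 1 0 = u 1 0 * v 0 0"
    by (intro quasi_periodic_solutions_dependent[OF L L])
       (use \<mu>(1) Lam01 s in \<open>simp_all add: u0 v0 u2 flip: Lam_def\<close>)
  then show False using ne[of 0 1] by (simp add: u0 v0)
qed

subsection \<open>Large amplitudes\<close>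

text \<open>The left side is the integral of \<nu> sin x. Writing the integrand as
  \<open>\<nu> * sin x * x' / x'\<close> and integrating by parts gives boundary terms of size
  \<bar>\<nu>\<bar> / m each and an integrand at most
  \<open>\<bar>\<nu>\<bar> * \<bar>x''\<bar> / x'^2\<close>, where \<open>\<bar>x''\<bar> \<le>
  \<bar>\<nu>\<bar> * \<bar>x'\<bar> + \<bar>s\<bar>\<close>.\<close>

lemma nonstationary_phase:
  assumes x: "solves_lift \<nu> a s x" and "\<alpha> \<le> \<beta>" "m > 0"
    and m: "\<And>t. t \<in> {\<alpha>..\<beta>} \<Longrightarrow> m \<le> \<bar>\<nu> * sin (x t) + a + s * sin t\<bar>"
  shows "\<bar>(x \<beta> - a * \<beta> + s * cos \<beta>) - (x \<alpha> - a * \<alpha> + s * cos \<alpha>)\<bar>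
    \<le> 2 * \<bar>\<nu>\<bar> / m + \<bar>\<nu>\<bar> * (\<bar>\<nu>\<bar> / m + \<bar>s\<bar> / m\<^sup>2) * (\<beta> - \<alpha>)"
proof -
  define x' where "x' t = \<nu> * sin (x t) + a + s * sin t" for t
  define x'' where "x'' t = \<nu> * cos (x t) * x' t + s * cos t" for t
  have x': "(x has_real_derivative x' t) (at t)" for t
    using x by (simp add: solves_lift_def x'_def)
  have x'': "(x' has_real_derivative x'' t) (at t)" for t
    unfolding x'_def x''_def by (auto intro!: derivative_eq_intros x'[unfolded x'_def])
  have m': "m \<le> \<bar>x' t\<bar>" "x' t \<noteq> 0" if "t \<in> {\<alpha>..\<beta>}" for t
    using m[OF that] \<open>m > 0\<close> by (auto simp: x'_def)
  \<comment> \<open>the boundary term of integrating \<open>\<nu> sin x\<close> by parts against the fast phase \<open>x\<close>\<close>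
  define q where "q t = \<nu> * cos (x t) / x' t" for t
  define Y where "Y t = x t - a * t + s * cos t + q t" for t
  define K where "K = \<bar>\<nu>\<bar> * (\<bar>\<nu>\<bar> / m + \<bar>s\<bar> / m\<^sup>2)"
  have "norm (Y \<beta> - Y \<alpha>) \<le> K * norm (\<beta> - \<alpha>)"
  proof (rule field_differentiable_bound[where S = "{\<alpha>..\<beta>}"])
    fix t assume t: "t \<in> {\<alpha>..\<beta>}"
    have "(Y has_real_derivative x' t - a - s * sin t
        + (\<nu> * (- sin (x t) * x' t) * x' t - \<nu> * cos (x t) * x'' t) / (x' t * x' t)) (at t)"
      unfolding Y_def q_def using m'[OF t]
      by (auto intro!: derivative_eq_intros x' x'')
    moreover have "x' t - a - s * sin t
        + (\<nu> * (- sin (x t) * x' t) * x' t - \<nu> * cos (x t) * x'' t) / (x' t * x' t)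
        = - \<nu> * cos (x t) * x'' t / (x' t)\<^sup>2"
    proof -
      have drift: "x' t - a - s * sin t = \<nu> * sin (x t)" by (simp add: x'_def)
      show ?thesis unfolding drift using m'(2)[OF t] by (simp add: field_simps power2_eq_square)
    qed
    ultimately show "(Y has_real_derivative - \<nu> * cos (x t) * x'' t / (x' t)\<^sup>2) (at t within {\<alpha>..\<beta>})"
      by (auto intro: DERIV_subset)
    have c: "\<bar>cos y\<bar> \<le> 1" for y :: real by simp
    have "\<bar>x'' t\<bar> \<le> \<bar>\<nu>\<bar> * \<bar>x' t\<bar> + \<bar>s\<bar>"
    proof -
      have "\<bar>x'' t\<bar> \<le> \<bar>\<nu> * cos (x t) * x' t\<bar> + \<bar>s * cos t\<bar>" unfolding x''_def by (rule abs_triangle_ineq)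
      also have "\<dots> \<le> \<bar>\<nu>\<bar> * \<bar>x' t\<bar> + \<bar>s\<bar>"
        unfolding abs_mult by (intro add_mono mult_right_mono mult_left_le) (auto intro: mult_left_le)
      finally show ?thesis .
    qed
    then have "\<bar>cos (x t)\<bar> * \<bar>x'' t\<bar> \<le> 1 * (\<bar>\<nu>\<bar> * \<bar>x' t\<bar> + \<bar>s\<bar>)"
      by (intro mult_mono) auto
    then have "\<bar>\<nu>\<bar> * (\<bar>cos (x t)\<bar> * \<bar>x'' t\<bar>) / (x' t)\<^sup>2 \<le> \<bar>\<nu>\<bar> * (\<bar>\<nu>\<bar> * \<bar>x' t\<bar> + \<bar>s\<bar>) / (x' t)\<^sup>2"
      by (intro divide_right_mono mult_left_mono) auto
    also have "\<dots> = \<bar>\<nu>\<bar> * (\<bar>\<nu>\<bar> / \<bar>x' t\<bar> + \<bar>s\<bar> / \<bar>x' t\<bar>\<^sup>2)"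
    proof -
      have "n * (n * z + p) / z\<^sup>2 = n * (n / z + p / z\<^sup>2)" if "z \<noteq> 0" for n p z :: real
        using that by (simp add: field_simps power2_eq_square)
      from this[of "\<bar>x' t\<bar>" "\<bar>\<nu>\<bar>" "\<bar>s\<bar>"] show ?thesis using m'(2)[OF t] by simp
    qed
    also have "\<dots> \<le> K"
      unfolding K_def using m'(1)[OF t] \<open>m > 0\<close>
      by (intro mult_left_mono add_mono divide_left_mono power_mono mult_pos_pos zero_less_power) auto
    finally show "norm (- \<nu> * cos (x t) * x'' t / (x' t)\<^sup>2) \<le> K"
      by (simp add: abs_mult abs_divide mult.assoc)
  qed (use \<open>\<alpha> \<le> \<beta>\<close> in auto)
  then have "\<bar>Y \<beta> - Y \<alpha>\<bar> \<le> K * (\<beta> - \<alpha>)" using \<open>\<alpha> \<le> \<beta>\<close> by simp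
  moreover have "\<bar>q t\<bar> \<le> \<bar>\<nu>\<bar> / m" if "t \<in> {\<alpha>..\<beta>}" for t
  proof -
    have "\<bar>q t\<bar> = \<bar>\<nu>\<bar> * \<bar>cos (x t)\<bar> / \<bar>x' t\<bar>" by (simp add: q_def abs_mult abs_divide)
    also have "\<dots> \<le> \<bar>\<nu>\<bar> / m"
      using m'[OF that] \<open>m > 0\<close> by (intro frac_le mult_left_le) auto
    finally show ?thesis .
  qed
  from this[of \<alpha>] this[of \<beta>] have "\<bar>q \<alpha>\<bar> \<le> \<bar>\<nu>\<bar> / m" "\<bar>q \<beta>\<bar> \<le> \<bar>\<nu>\<bar> / m" using \<open>\<alpha> \<le> \<beta>\<close> by auto
  ultimately have "\<bar>(x \<beta> - a * \<beta> + s * cos \<beta>) - (x \<alpha> - a * \<alpha> + s * cos \<alpha>)\<bar>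
      \<le> 2 * (\<bar>\<nu>\<bar> / m) + K * (\<beta> - \<alpha>)"
    unfolding Y_def by linarith
  then show ?thesis by (simp add: K_def)
qed

lemma sin_ge_sin_cutoff:
  fixes \<delta> t :: real
  assumes "0 < \<delta>" "\<delta> \<le> 1" "\<delta> \<le> t" "t \<le> pi - \<delta>"
  shows "sin \<delta> \<le> sin t"
proof (cases "t \<le> pi / 2")
  case True
  then show ?thesis using assms by (intro sin_monotone_2pi_le) auto
next
  case False
  have "sin \<delta> \<le> sin (pi - t)" using assms False pi_gt3 by (intro sin_monotone_2pi_le) auto
  then show ?thesis by simp
qed

text \<open>The quantity is the integral of \<nu> sin x over a period. Within \<delta> of the zeros
  of \<open>sin t\<close> the integrand is bounded by \<bar>\<nu>\<bar>; on the two remaining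
  intervals the phase is fast and the integral is of order \<open>1 / \<bar>s\<bar>\<close>.\<close>

lemma period_displacement_large_amplitude:
  assumes "\<nu> \<noteq> 0"
  obtains M where "M > 0" "\<And>a s x. \<lbrakk>\<bar>a\<bar> \<le> A; \<bar>s\<bar> > M; solves_lift \<nu> a s x\<rbrakk>
      \<Longrightarrow> \<bar>x (2 * pi) - x 0 - 2 * pi * a\<bar> < 2 * pi"
proof -
  \<comment> \<open>The excluded neighbourhoods have total length \<open>4 * \<delta>\<close> and so
    contribute at most 2.\<close>
  define \<delta> where "\<delta> = min 1 (1 / (2 * \<bar>\<nu>\<bar>))"
  have \<delta>: "0 < \<delta>" "\<delta> \<le> 1" "4 * \<delta> * \<bar>\<nu>\<bar> \<le> 2"
    using assms by (auto simp: \<delta>_def min_def field_simps)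
  \<comment> \<open>Half of \<open>sin \<delta>\<close> is kept for the lower bound
    \<open>m = \<bar>s\<bar> * c\<close> on the speed; the other half absorbs \<nu> sin x +
    a.\<close>
  define c where "c = sin \<delta> / 2"
  have "c > 0" using sin_gt_zero_02[of \<delta>] \<delta> by (simp add: c_def)
  \<comment> \<open>\<open>K / \<bar>s\<bar>\<close> is the total bound for the two nonstationary
    intervals.\<close>
  define K where "K = 2 * (2 * \<bar>\<nu>\<bar> / c + \<bar>\<nu>\<bar> * (\<bar>\<nu>\<bar> / c + 1 / c\<^sup>2) * pi)"
  have "K \<ge> 0" using \<open>c > 0\<close> by (simp add: K_def)
  \<comment> \<open>The summand \<open>K\<close> makes that bound less than 1, and the second one
    ensures \<open>\<bar>\<nu>\<bar> + \<bar>a\<bar> \<le> m\<close>.\<close>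
  define M where "M = K + (\<bar>\<nu>\<bar> + \<bar>A\<bar>) / c + 1"
  have "M > 0" using \<open>K \<ge> 0\<close> \<open>c > 0\<close> by (simp add: M_def add_nonneg_pos)
  moreover have "\<bar>x (2 * pi) - x 0 - 2 * pi * a\<bar> < 2 * pi"
    if a: "\<bar>a\<bar> \<le> A" and s: "\<bar>s\<bar> > M" and x: "solves_lift \<nu> a s x" for a s x
  proof -
    define S where "S = \<bar>s\<bar>"
    have S: "S > 0" "S > K" "S > (\<bar>\<nu>\<bar> + \<bar>A\<bar>) / c"
      using s \<open>M > 0\<close> \<open>K \<ge> 0\<close> \<open>c > 0\<close> by (auto simp: S_def M_def intro: le_less_trans[rotated])
    define m where "m = S * c"
    have "m > 0" using S \<open>c > 0\<close> by (simp add: m_def)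
    have m2: "\<bar>\<nu>\<bar> + \<bar>a\<bar> \<le> m"
      using S(3) \<open>c > 0\<close> a by (simp add: m_def field_simps)
    define y where "y t = x t - a * t + s * cos t" for t
    have low: "m \<le> \<bar>\<nu> * sin (x t) + a + s * sin t\<bar>" if "\<bar>sin t\<bar> \<ge> sin \<delta>" for t
    proof -
      have "S * sin \<delta> \<le> S * \<bar>sin t\<bar>" using that S by (intro mult_left_mono) auto
      then have "2 * m \<le> \<bar>s * sin t\<bar>" by (simp add: m_def c_def S_def abs_mult)
      moreover have "\<bar>\<nu> * sin (x t)\<bar> \<le> \<bar>\<nu>\<bar>" by (simp add: abs_mult mult_left_le)
      ultimately show ?thesis using m2 by linarith
    qed
    define B where "B = 2 * \<bar>\<nu>\<bar> / m + \<bar>\<nu>\<bar> * (\<bar>\<nu>\<bar> / m + \<bar>s\<bar> / m\<^sup>2) * pi"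
    have phase: "\<bar>y \<beta> - y \<alpha>\<bar> \<le> B" if "\<alpha> \<le> \<beta>" "\<beta> - \<alpha> \<le> pi" "\<And>t. t \<in> {\<alpha>..\<beta>} \<Longrightarrow> \<bar>sin t\<bar> \<ge> sin \<delta>" for \<alpha> \<beta>
    proof -
      have "\<bar>y \<beta> - y \<alpha>\<bar> \<le> 2 * \<bar>\<nu>\<bar> / m + \<bar>\<nu>\<bar> * (\<bar>\<nu>\<bar> / m + \<bar>s\<bar> / m\<^sup>2) * (\<beta> - \<alpha>)"
        unfolding y_def by (rule nonstationary_phase[OF x \<open>\<alpha> \<le> \<beta>\<close> \<open>m > 0\<close> low[OF that(3)]])
      also have "\<dots> \<le> B"
        unfolding B_def using that(2) \<open>m > 0\<close> by (intro add_left_mono mult_left_mono) auto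
      finally show ?thesis .
    qed
    have short: "\<bar>y \<beta> - y \<alpha>\<bar> \<le> \<bar>\<nu>\<bar> * (\<beta> - \<alpha>)" if "\<alpha> \<le> \<beta>" for \<alpha> \<beta>
    proof -
      have "norm (y \<beta> - y \<alpha>) \<le> \<bar>\<nu>\<bar> * norm (\<beta> - \<alpha>)"
      proof (rule field_differentiable_bound[OF convex_UNIV])
        show "(y has_real_derivative \<nu> * sin (x \<tau>)) (at \<tau> within UNIV)" for \<tau>
          using x unfolding y_def solves_lift_def by (auto intro!: derivative_eq_intros)
      qed (auto simp: abs_mult mult_left_le)
      then show ?thesis using that by simp
    qed
    define w where "w = \<bar>\<nu>\<bar> * \<delta>"
    have "\<bar>y \<delta> - y 0\<bar> \<le> w" using short[of 0 \<delta>] \<delta> by (simp add: w_def)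
    moreover have "\<bar>y (pi - \<delta>) - y \<delta>\<bar> \<le> B"
      using sin_ge_sin_cutoff[OF \<delta>(1,2)] \<delta> pi_gt3 by (intro phase) (auto intro: abs_ge_self order_trans)
    moreover have "\<bar>y (pi + \<delta>) - y (pi - \<delta>)\<bar> \<le> 2 * w"
      using short[of "pi - \<delta>" "pi + \<delta>"] \<delta> by (simp add: w_def)
    moreover have "\<bar>y (2 * pi - \<delta>) - y (pi + \<delta>)\<bar> \<le> B"
    proof (intro phase)
      fix t assume "t \<in> {pi + \<delta>..2 * pi - \<delta>}"
      then have "sin \<delta> \<le> sin (t - pi)" by (intro sin_ge_sin_cutoff[OF \<delta>(1,2)]) auto
      then show "sin \<delta> \<le> \<bar>sin t\<bar>" by (simp add: sin_diff)
    qed (use \<delta> pi_gt3 in auto)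
    moreover have "\<bar>y (2 * pi) - y (2 * pi - \<delta>)\<bar> \<le> w"
      using short[of "2 * pi - \<delta>" "2 * pi"] \<delta> by (simp add: w_def)
    ultimately have "\<bar>y (2 * pi) - y 0\<bar> \<le> 4 * w + 2 * B" by linarith
    moreover have "2 * B = K / S"
      using S(1) \<open>c > 0\<close> by (simp add: B_def K_def m_def S_def[symmetric] field_simps power2_eq_square)
    moreover have "K / S < 1" using S by simp
    moreover have "4 * w \<le> 2" using \<delta>(3) by (simp add: w_def mult_ac)
    \<comment> \<open>The contributions sum to less than 2 + 1, which is below
      \<open>2 * pi\<close>.\<close>
    ultimately have "\<bar>y (2 * pi) - y 0\<bar> < 2 * pi" using pi_gt3 by linarith
    then show ?thesis by (simp add: y_def algebra_simps)
  qed
  ultimately show thesis using that by blast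
qed

section \<open>Integrality of \<open>a\<close> combined with the large-amplitude estimate\<close>

theorem corollary1p3:
  fixes \<nu> :: real and r :: int
  assumes "\<nu> \<noteq> 0"
  shows "\<exists>M>0. \<forall>a s. is_adjacency \<nu> (of_int r) (a, s) \<and> \<bar>s\<bar> > M \<longrightarrow> a = of_int r"
proof -
  \<comment> \<open>Every \<open>a\<close> with rotation number \<open>r\<close> satisfies this
    bound, so the threshold \<open>M\<close> depends only on \<nu> and \<open>r\<close>.\<close>
  obtain M where "M > 0" and M: "\<And>a s x. \<lbrakk>\<bar>a\<bar> \<le> \<bar>of_int r\<bar> + \<bar>\<nu>\<bar>; \<bar>s\<bar> > M; solves_lift \<nu> a s x\<rbrakk>
      \<Longrightarrow> \<bar>x (2 * pi) - x 0 - 2 * pi * a\<bar> < 2 * pi"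
    using period_displacement_large_amplitude[OF assms, of "\<bar>of_int r\<bar> + \<bar>\<nu>\<bar>"] by blast
  have "a = of_int r" if adj: "is_adjacency \<nu> (of_int r) (a, s)" and s: "\<bar>s\<bar> > M" for a s
  proof -
    have "rotation_number \<nu> a s = of_int r"
      using adjacency_tongue_slice[OF adj] by (auto simp: tongue_slice_def arnold_tongue_def)
    then have "\<bar>a\<bar> \<le> \<bar>of_int r\<bar> + \<bar>\<nu>\<bar>" using rotation_number_near[of \<nu> a s] by linarith
    moreover obtain x where x: "solves_lift \<nu> a s x" using solves_lift_exists by blast
    ultimately have "\<bar>2 * pi * (of_int r - a)\<bar> < 2 * pi"
      using M[OF _ s x] adjacency_period_map[OF adj x] by (simp add: algebra_simps)
    then have "\<bar>of_int r - a\<bar> < 1" by (simp add: abs_mult)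
    moreover have "a \<in> \<int>"
      using s \<open>M > 0\<close> by (intro identity_period_map_imp_int[OF _ adjacency_period_map[OF adj]]) auto
    then obtain k where k: "a = of_int k" by (rule Ints_cases)
    ultimately have "\<bar>r - k\<bar> < 1" by linarith
    then show ?thesis using k by simp
  qed
  with \<open>M > 0\<close> show ?thesis by blast
qed

end
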